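(* Fix $r\in(0,\infty)$. Let $(s_n)_{n\ge1}$ be a sequence of positive integers with $s_n\le n$, put $\eta_n=s_n/n$, and assume $\eta_n\to0$. Let $\hat p_{T,\mathrm{CL}}(y|x)=\prod_{i=1}^n\hat p_T(y_i|x_i)$ be the product predictive threshold estimator, where $\hat p_T$ is the univariate threshold estimator with threshold $\lambda_e=\lambda_e(\eta_n)$ built on the cluster prior $\pi_{\mathrm{CL}}[\eta_n,r]$ (as defined in the context with $\eta=\eta_n$). Then $\hat p_{T,\mathrm{CL}}$ is asymptotically minimax: $$\sup_{\theta\in\Theta_n[s_n]}\rho(\theta,\hat p_{T,\mathrm{CL}})=R_N(\Theta_n[s_n])\,(1+o(1))\qquad\text{as } n\to\infty.$$
   Context: Model: for $\theta\in\mathbb{R}^n$, the past observation $X\sim N_n(\theta,I)$ and the future observation $Y\sim N_n(\theta,rI)$ are independent given $\theta$; $r>0$ is known and fixed. Write $p(x|\theta,1)$ and $p(y|\theta,r)$ for their densities. A predictive density estimator is a measurable $\hat p(y|x)$ such that $\hat p(\cdot|x)$ is a probability density on $\mathbb{R}^n$ for each $x\in\mathbb{R}^n$. Its Kullback--Leibler loss is $L(\theta,\hat p(\cdot|x))=\int p(y|\theta,r)\log\frac{p(y|\theta,r)}{\hat p(y|x)}\,dy$ and its risk is $\rho(\theta,\hat p)=\int L(\theta,\hat p(\cdot|x))\,p(x|\theta,1)\,dx$. Parameter space: $\Theta_n[s]=\{\theta\in\mathbb{R}^n:\#\{i:\theta_i\ne0\}\le s\}$. Minimax risk: $R_N(\Theta)=\inf_{\hat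 p}\sup_{\theta\in\Theta}\rho(\theta,\hat p)$, over all predictive density estimators. Univariate threshold estimator with cluster prior. Let $\eta>0$ be small, $v_w=(1+r^{-1})^{-1}$, $\lambda_e=\sqrt{2\log(\eta^{-1}(1-\eta))}$, $\lambda_f=\sqrt{v_w}\,\lambda_e$, and $a=\sqrt{2\log\lambda_f}$ (well defined for $\eta$ small). Let $\mu_\eta$ be the positive root $\mu$ of $\mu^2+2a\mu=\lambda_e^2$, and $\nu_\eta=\sqrt{v_w}\,\mu_\eta$. Put $\mu_1=\nu_\eta$, $\mu_{k+1}=(1+2r)^k\nu_\eta$ for $k\ge1$, and $K=\max\{k:\mu_k\le\lambda_e+a\}$. The cluster prior is $$\pi_{\mathrm{CL}}[\eta,r]=(1-\eta)\delta_0+\frac{\eta}{2K}\sum_{k=1}^K(\delta_{\mu_k}+\delta_{-\mu_k}),$$ $\delta_\mu$ being the unit point mass at $\mu$. For a prior $\pi$ on $\mathbb{R}$, its Bayes predictive density is $\hat p_\pi(y_1|x_1)=\int\phi(y_1|\theta,r)\,\pi(d\theta|x_1)$, where $\phi(\cdot|\theta,v)$ is the $N(\theta,v)$ density and $\pi(d\theta|x_1)$ is the posterior given $X_1=x_1$ when $X_1|\theta\sim N(\theta,1)$. Let $\hat p_U(\cdot|x_1)$ be the $N(x_1,1+r)$ density. Then, with $\pi=\pi_{\mathrm{CL}}[\eta,r]$, $$\hat p_T(y_1|x_1)=\begin{cases}\hat p_\pi(y_1|x_1),&|x_1|\le\lambda_e,\\ \hat p_U(y_1|x_1),&|x_1|>\lambda_e.\end{cases}$$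 *)

theory Defs
  imports "HOL-Probability.Probability"
begin

text \<open>Since \<open>n\<close> tends to infinity, a vector of \<open>\<real>\<^sup>n\<close> is an extensional function on \<open>{..<n}\<close>, and
  the reference measure is the \<open>n\<close>-fold product of one-dimensional Lebesgue measures.\<close>

definition Rn :: "nat \<Rightarrow> (nat \<Rightarrow> real) measure" where
  "Rn n = PiM {..<n} (\<lambda>_. lborel)"

text \<open>The library's \<open>normal_density\<close> takes the standard deviation; here \<open>v\<close> is the variance.\<close>

definition gauss1 :: "real \<Rightarrow> real \<Rightarrow> real \<Rightarrow> real" where
  "gauss1 \<theta> v x = normal_density \<theta> (sqrt v) x"

definition gauss :: "nat \<Rightarrow> (nat \<Rightarrow> real) \<Rightarrow> real \<Rightarrow> (nat \<Rightarrow> real) \<Rightarrow> real" where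
  "gauss n \<theta> v x = (\<Prod>i<n. gauss1 (\<theta> i) v (x i))"

text \<open>In all estimators below, \<open>p x y\<close> stands for \<open>p(y|x)\<close>.\<close>

definition predictive_density :: "nat \<Rightarrow> ((nat \<Rightarrow> real) \<Rightarrow> (nat \<Rightarrow> real) \<Rightarrow> real) \<Rightarrow> bool" where
  "predictive_density n p \<longleftrightarrow>
     (\<lambda>(x, y). p x y) \<in> borel_measurable (Rn n \<Otimes>\<^sub>M Rn n) \<and>
     (\<forall>x \<in> space (Rn n).
        (\<forall>y \<in> space (Rn n). 0 \<le> p x y) \<and> (\<integral>\<^sup>+ y. ennreal (p x y) \<partial>Rn n) = 1)"

text \<open>Integral of an extended real function, as positive part minus negative part (\<open>e2ennreal\<close> maps
  negative values to \<open>0\<close>). Both uses below have a finite negative part, because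
  \<open>p * ln (p / q) \<ge> - q / e\<close> and the Kullback--Leibler loss is nonnegative, so the case
  \<open>\<infinity> - \<infinity>\<close> does not arise.\<close>

definition ereal_integral :: "'a measure \<Rightarrow> ('a \<Rightarrow> ereal) \<Rightarrow> ereal" where
  "ereal_integral M f =
     enn2ereal (\<integral>\<^sup>+ x. e2ennreal (f x) \<partial>M) - enn2ereal (\<integral>\<^sup>+ x. e2ennreal (- f x) \<partial>M)"

text \<open>The loss may be infinite, so the library's real-valued \<open>KL_divergence\<close> is not suitable. The true
  density is positive everywhere, so the integrand is \<open>\<infinity>\<close> where \<open>q\<close> vanishes.\<close>

definition KL_loss :: "nat \<Rightarrow> real \<Rightarrow> (nat \<Rightarrow> real) \<Rightarrow> ((nat \<Rightarrow> real) \<Rightarrow> real) \<Rightarrow> ereal" where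
  "KL_loss n r \<theta> q =
     ereal_integral (Rn n)
       (\<lambda>y. if q y = 0 then \<infinity> else ereal (gauss n \<theta> r y * ln (gauss n \<theta> r y / q y)))"

definition risk ::
  "nat \<Rightarrow> real \<Rightarrow> (nat \<Rightarrow> real) \<Rightarrow> ((nat \<Rightarrow> real) \<Rightarrow> (nat \<Rightarrow> real) \<Rightarrow> real) \<Rightarrow> ereal" where
  "risk n r \<theta> p = ereal_integral (Rn n) (\<lambda>x. KL_loss n r \<theta> (p x) * ereal (gauss n \<theta> 1 x))"

definition sparse_vecs :: "nat \<Rightarrow> nat \<Rightarrow> (nat \<Rightarrow> real) set" where
  "sparse_vecs n s = {\<theta> \<in> space (Rn n). card {i \<in> {..<n}. \<theta> i \<noteq> 0} \<le> s}"

definition minimax_risk :: "nat \<Rightarrow> real \<Rightarrow> (nat \<Rightarrow> real) set \<Rightarrow> ereal" where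
  "minimax_risk n r \<Theta> = (INF p \<in> {p. predictive_density n p}. SUP \<theta> \<in> \<Theta>. risk n r \<theta> p)"

definition posterior :: "real measure \<Rightarrow> real \<Rightarrow> real measure" where
  "posterior \<pi> x = density \<pi> (\<lambda>\<theta>. ennreal (gauss1 \<theta> 1 x / (\<integral>t. gauss1 t 1 x \<partial>\<pi>)))"

definition bayes_pred :: "real \<Rightarrow> real measure \<Rightarrow> real \<Rightarrow> real \<Rightarrow> real" where
  "bayes_pred r \<pi> x y = (\<integral>\<theta>. gauss1 \<theta> r y \<partial>posterior \<pi> x)"

definition v_w :: "real \<Rightarrow> real" where
  "v_w r = inverse (1 + inverse r)"

definition lam_e :: "real \<Rightarrow> real" where
  "lam_e \<eta> = sqrt (2 * ln (inverse \<eta> * (1 - \<eta>)))"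

definition lam_f :: "real \<Rightarrow> real \<Rightarrow> real" where
  "lam_f r \<eta> = sqrt (v_w r) * lam_e \<eta>"

definition offset :: "real \<Rightarrow> real \<Rightarrow> real" where
  "offset r \<eta> = sqrt (2 * ln (lam_f r \<eta>))"

definition mu_root :: "real \<Rightarrow> real \<Rightarrow> real" where
  "mu_root r \<eta> = (THE \<mu>. \<mu> > 0 \<and> \<mu>\<^sup>2 + 2 * offset r \<eta> * \<mu> = (lam_e \<eta>)\<^sup>2)"

definition nu :: "real \<Rightarrow> real \<Rightarrow> real" where
  "nu r \<eta> = sqrt (v_w r) * mu_root r \<eta>"

text \<open>Only indices \<open>k \<ge> 1\<close> are used.\<close>

definition support_pt :: "real \<Rightarrow> real \<Rightarrow> nat \<Rightarrow> real" where
  "support_pt r \<eta> k = (1 + 2 * r) ^ (k - 1) * nu r \<eta>"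

definition num_pts :: "real \<Rightarrow> real \<Rightarrow> nat" where
  "num_pts r \<eta> = Max {k. 1 \<le> k \<and> support_pt r \<eta> k \<le> lam_e \<eta> + offset r \<eta>}"

definition cluster_mass :: "real \<Rightarrow> real \<Rightarrow> real \<Rightarrow> real" where
  "cluster_mass r \<eta> t =
     (1 - \<eta>) * indicator {0} t +
     \<eta> / (2 * real (num_pts r \<eta>)) *
       (\<Sum>k = 1..num_pts r \<eta>.
          indicator {support_pt r \<eta> k} t + indicator {- support_pt r \<eta> k} t)"

definition cluster_prior :: "real \<Rightarrow> real \<Rightarrow> real pmf" where
  "cluster_prior r \<eta> = embed_pmf (cluster_mass r \<eta>)"

text \<open>For small \<open>\<eta>\<close>, the mass function is a genuine one, so \<open>embed_pmf\<close> is meaningful.\<close>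

lemma pmf_cluster_prior:
  assumes "0 \<le> \<eta>" "\<eta> \<le> 1" "1 \<le> num_pts r \<eta>"
  shows "pmf (cluster_prior r \<eta>) t = cluster_mass r \<eta> t"
proof -
  let ?K = "num_pts r \<eta>"
  let ?m = "support_pt r \<eta>"
  have nonneg: "0 \<le> cluster_mass r \<eta> t" for t
    using assms unfolding cluster_mass_def by (intro add_nonneg_nonneg mult_nonneg_nonneg sum_nonneg) auto
  have eq: "ennreal (cluster_mass r \<eta> t) =
      ennreal (1 - \<eta>) * indicator {0} t + ennreal (\<eta> / (2 * real ?K)) *
        (\<Sum>k = 1..?K. indicator {?m k} t + indicator {- ?m k} t)" for t
  proof -
    have "ennreal (\<Sum>k = 1..?K. indicator {?m k} t + indicator {- ?m k} t) =
        (\<Sum>k = 1..?K. indicator {?m k} t + indicator {- ?m k} t)"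
      by (subst sum_ennreal [symmetric]) (auto simp: ennreal_plus ennreal_indicator)
    moreover have "ennreal (cluster_mass r \<eta> t) =
        ennreal (1 - \<eta>) * ennreal (indicator {0} t) + ennreal (\<eta> / (2 * real ?K)) *
          ennreal (\<Sum>k = 1..?K. indicator {?m k} t + indicator {- ?m k} t)"
      unfolding cluster_mass_def using assms
      by (subst ennreal_plus)
        (auto intro!: mult_nonneg_nonneg sum_nonneg divide_nonneg_nonneg simp: ennreal_mult sum_nonneg simp del: times_divide_eq_left)
    ultimately show ?thesis by (simp add: ennreal_indicator)
  qed
  have "(\<integral>\<^sup>+ t. ennreal (cluster_mass r \<eta> t) \<partial>count_space UNIV) =
    (\<integral>\<^sup>+ t. ennreal (1 - \<eta>) * indicator {0} t + ennreal (\<eta> / (2 * real ?K)) *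
       (\<Sum>k = 1..?K. indicator {?m k} t + indicator {- ?m k} t) \<partial>count_space UNIV)"
    by (simp only: eq)
  also have "\<dots> = ennreal (1 - \<eta>) + ennreal (\<eta> / (2 * real ?K)) * (\<Sum>k = 1..?K. 2)"
    by (simp add: nn_integral_add nn_integral_cmult nn_integral_sum one_add_one)
  also have "\<dots> = ennreal (1 - \<eta>) + ennreal (\<eta> / (2 * real ?K)) * ennreal (2 * real ?K)"
    by (simp add: ennreal_mult ennreal_of_nat_eq_real_of_nat mult.commute)
  also have "\<dots> = ennreal ((1 - \<eta>) + (\<eta> / (2 * real ?K)) * (2 * real ?K))"
    using assms by (subst ennreal_plus) (auto simp: ennreal_mult [symmetric])
  also have "\<dots> = 1"
    using assms by simp
  finally show ?thesis
    unfolding cluster_prior_def by (intro pmf_embed_pmf nonneg)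
qed

definition threshold1 :: "real \<Rightarrow> real \<Rightarrow> real \<Rightarrow> real \<Rightarrow> real" where
  "threshold1 r \<eta> x y =
     (if \<bar>x\<bar> \<le> lam_e \<eta> then bayes_pred r (measure_pmf (cluster_prior r \<eta>)) x y
      else gauss1 x (1 + r) y)"

definition threshold_est :: "nat \<Rightarrow> real \<Rightarrow> real \<Rightarrow> (nat \<Rightarrow> real) \<Rightarrow> (nat \<Rightarrow> real) \<Rightarrow> real" where
  "threshold_est n r \<eta> x y = (\<Prod>i<n. threshold1 r \<eta> (x i) (y i))"

end

theory Submission
  imports Defs "HOL-Real_Asymp.Real_Asymp"
begin

text \<open>Write \<open>l = lam_e \<eta>\<close>, so that \<open>exp (l\<^sup>2 / 2) = (1 - \<eta>) / \<eta>\<close>, and \<open>v = r / (1 + r)\<close>, which is the variance of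
  the weighted mean \<open>(r x + y) / (1 + r)\<close> of past and future observation. Both the minimax risk and
  the worst risk of the threshold estimator are \<open>s l\<^sup>2 / (2 (1 + r))\<close> to first order, and the
  proof shows this by an explicit upper and an explicit lower bound.

  Lower bound (\<open>risk_ge\<close>, \<open>minimax_risk_ge\<close>). The risk of \<open>p\<close> at \<open>\<theta>\<close> is the divergence of the law of
  \<open>(x, y)\<close> from the density \<open>gauss n 0 1 x * p x y\<close>, minus \<open>\<bar>\<theta>\<bar>\<^sup>2 / 2\<close>: the past
  observation alone has divergence \<open>\<bar>\<theta>\<bar>\<^sup>2 / 2\<close> from \<open>gauss n 0 1\<close>. So it is enough to find many vectors
  \<open>\<theta>\<close> of small norm that \<open>(x, y)\<close> identifies: no single density is then close to all their laws.
  Cut the \<open>n\<close> coordinates into \<open>s\<close> blocks of length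
  \<open>m = n div s\<close> and put one spike of height slightly above \<open>sqrt v * l\<close> at an arbitrary place of each
  block. At noise level \<open>v\<close> this spike can be located, so the divergence is about \<open>ln m\<close>, nearly
  \<open>l\<^sup>2 / 2\<close>, per block; subtracting half the squared height leaves
  \<open>(1 - v) l\<^sup>2 / 2 = l\<^sup>2 / (2 (1 + r))\<close>. A variational bound for the divergence, with a test function
  that adds up over the blocks, avoids every union over blocks and works for bounded as well as growing \<open>s\<close>.

  Upper bound (\<open>risk_product_le\<close>, \<open>sup_risk_le\<close>). The risk of a product estimator is at most the sum of
  univariate risks. A zero coordinate costs \<open>O (\<eta> l)\<close>, so all of them together \<open>O (s l)\<close>
  (\<open>risk1_zero\<close>). A nonzero coordinate costs \<open>l\<^sup>2 / (2 (1 + r)) + o (l\<^sup>2)\<close> uniformly in its value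
  (\<open>risk1_all\<close>): above the threshold the loss is bounded in the mean, and below it the mixture density
  is bounded from below by a single, well chosen atom of the cluster prior. The atom \<open>0\<close> serves for
  \<open>\<bar>\<theta>\<bar> \<le> lam_f\<close>, where \<open>\<theta>\<^sup>2 / (2 r)\<close> is small enough, and for \<open>\<bar>\<theta>\<bar> \<ge> lam_e + a\<close>, where staying below the
  threshold is improbable; in between the largest support point below \<open>\<bar>\<theta>\<bar>\<close> serves.

  Since the threshold estimator is itself a predictive density, its worst risk is at least the minimax
  risk, and the two bounds have ratio tending to \<open>1\<close>.\<close>

section \<open>Gaussian integrals\<close>

definition glaw :: "real \<Rightarrow> real \<Rightarrow> real measure" where
  "glaw \<theta> v = density lborel (\<lambda>x. ennreal (gauss1 \<theta> v x))"

definition gauss_law :: "nat \<Rightarrow> (nat \<Rightarrow> real) \<Rightarrow> real \<Rightarrow> (nat \<Rightarrow> real) measure" where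
  "gauss_law n \<theta> v = PiM {..<n} (\<lambda>i. glaw (\<theta> i) v)"

lemma gauss1_eq: "0 < v \<Longrightarrow> gauss1 \<theta> v x = exp (- (x - \<theta>)\<^sup>2 / (2 * v)) / sqrt (2 * pi * v)"
  by (simp add: gauss1_def normal_density_def)

lemma gauss1_pos: "0 < v \<Longrightarrow> 0 < gauss1 \<theta> v x"
  by (simp add: gauss1_eq)

lemma gauss1_nonneg [simp]: "0 \<le> gauss1 \<theta> v x"
  by (simp add: gauss1_def)

lemma gauss1_measurable [measurable]: "gauss1 \<theta> v \<in> borel_measurable borel"
  by (simp add: gauss1_def [abs_def])

lemma gauss1_measurable_pair [measurable]:
  "(\<lambda>(x, y). gauss1 x v y) \<in> borel_measurable (borel \<Otimes>\<^sub>M borel)"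
  unfolding gauss1_def normal_density_def by measurable

lemma ln_gauss1: "0 < v \<Longrightarrow> ln (gauss1 \<theta> v x) = - (x - \<theta>)\<^sup>2 / (2 * v) - ln (2 * pi * v) / 2"
  by (simp add: gauss1_eq ln_div ln_sqrt)

lemma ln_gauss1_ratio:
  assumes "0 < v"
  shows "ln (gauss1 \<theta> v y / gauss1 \<mu> v y) = ((y - \<mu>)\<^sup>2 - (y - \<theta>)\<^sup>2) / (2 * v)"
  using assms gauss1_pos[OF assms, of \<theta> y] gauss1_pos[OF assms, of \<mu> y]
  by (simp add: ln_div ln_gauss1 diff_divide_distrib)

lemma gauss1_ratio: "gauss1 t 1 x = gauss1 0 1 x * exp (t * x - t\<^sup>2 / 2)"
  by (simp add: gauss1_eq power2_eq_square field_simps flip: exp_add)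

lemma sets_glaw [measurable_cong, simp]: "sets (glaw \<theta> v) = sets borel"
  and space_glaw [simp]: "space (glaw \<theta> v) = UNIV"
  by (simp_all add: glaw_def)

lemma prob_space_glaw: "0 < v \<Longrightarrow> prob_space (glaw \<theta> v)"
  using prob_space_normal_density[of "sqrt v" \<theta>] by (simp add: glaw_def gauss1_def)

lemma has_bochner_integral_glaw:
  assumes "has_bochner_integral lborel (\<lambda>x. gauss1 \<theta> v x * f x) c" "f \<in> borel_measurable borel"
  shows "has_bochner_integral (glaw \<theta> v) f c"
  unfolding glaw_def using assms by (intro has_bochner_integral_density) auto

lemma glaw_const:
  assumes "0 < v"
  shows "has_bochner_integral (glaw \<theta> v) (\<lambda>_. c :: real) c"
proof -
  interpret prob_space "glaw \<theta> v" by (rule prob_space_glaw[OF assms])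
  show ?thesis
    using prob_space by (simp add: has_bochner_integral_iff)
qed

lemma glaw_centred: "0 < v \<Longrightarrow> has_bochner_integral (glaw \<theta> v) (\<lambda>x. x - \<theta>) 0"
  using normal_moment_odd[of "sqrt v" \<theta> 0]
  by (intro has_bochner_integral_glaw) (simp_all add: gauss1_def)

lemma glaw_variance: "0 < v \<Longrightarrow> has_bochner_integral (glaw \<theta> v) (\<lambda>x. (x - \<theta>)\<^sup>2) v"
  using normal_moment_even[of "sqrt v" \<theta> 1]
  by (intro has_bochner_integral_glaw) (simp_all add: gauss1_def)

lemma glaw_square:
  assumes "0 < v"
  shows "has_bochner_integral (glaw \<theta> v) (\<lambda>x. (x - \<mu>)\<^sup>2) (v + (\<theta> - \<mu>)\<^sup>2)"
proof -
  have "has_bochner_integral (glaw \<theta> v)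
      (\<lambda>x. (x - \<theta>)\<^sup>2 + (2 * (\<theta> - \<mu>)) * (x - \<theta>) + (\<theta> - \<mu>)\<^sup>2)
      (v + (2 * (\<theta> - \<mu>)) * 0 + (\<theta> - \<mu>)\<^sup>2)"
    by (intro has_bochner_integral_add has_bochner_integral_mult_right glaw_const glaw_variance
        glaw_centred assms)
  then show ?thesis
    by (simp add: power2_eq_square algebra_simps)
qed

text \<open>Completing the square: the exponential tilt of a Gaussian is a shifted Gaussian.\<close>

lemma glaw_exp:
  assumes "0 < v"
  shows "has_bochner_integral (glaw \<theta> v) (\<lambda>x. exp (\<beta> * x)) (exp (\<beta> * \<theta> + \<beta>\<^sup>2 * v / 2))"
proof (rule has_bochner_integral_glaw)
  have "gauss1 \<theta> v x * exp (\<beta> * x) = exp (\<beta> * \<theta> + \<beta>\<^sup>2 * v / 2) * gauss1 (\<theta> + \<beta> * v) v x" for x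
  proof -
    have "- (x - \<theta>)\<^sup>2 / (2 * v) + \<beta> * x
        = \<beta> * \<theta> + \<beta>\<^sup>2 * v / 2 + - (x - (\<theta> + \<beta> * v))\<^sup>2 / (2 * v)"
      using assms by (simp add: field_simps power2_eq_square)
    then show ?thesis
      using assms by (simp add: gauss1_eq flip: exp_add)
  qed
  moreover have "has_bochner_integral lborel
      (\<lambda>x. exp (\<beta> * \<theta> + \<beta>\<^sup>2 * v / 2) * gauss1 (\<theta> + \<beta> * v) v x)
      (exp (\<beta> * \<theta> + \<beta>\<^sup>2 * v / 2) * 1)"
    using assms by (intro has_bochner_integral_mult_right)
      (auto simp: gauss1_def has_bochner_integral_iff)
  ultimately show "has_bochner_integral lborel (\<lambda>x. gauss1 \<theta> v x * exp (\<beta> * x))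
      (exp (\<beta> * \<theta> + \<beta>\<^sup>2 * v / 2))"
    by simp
qed simp

lemma space_Rn: "space (Rn n) = extensional {..<n}"
  by (simp add: Rn_def space_PiM PiE_def)

lemma gauss_measurable [measurable]: "gauss n \<theta> v \<in> borel_measurable (Rn n)"
  unfolding gauss_def Rn_def by measurable

lemma gauss_nonneg [simp]: "0 \<le> gauss n \<theta> v x"
  by (simp add: gauss_def prod_nonneg)

lemma gauss_pos: "0 < v \<Longrightarrow> 0 < gauss n \<theta> v x"
  by (simp add: gauss_def prod_pos gauss1_pos)

lemma sigma_finite_Rn: "sigma_finite_measure (Rn n)"
proof -
  interpret finite_product_sigma_finite "\<lambda>_::nat. lborel :: real measure" "{..<n}"
    by standard auto
  show ?thesis
    unfolding Rn_def by unfold_locales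
qed

text \<open>Expectations over independent coordinates are easy for the product of the laws, whereas the risk is
  defined with the density \<open>gauss\<close>; this identification passes between the two.\<close>

lemma gauss_law_eq_density:
  assumes v: "0 < v"
  shows "gauss_law n \<theta> v = density (Rn n) (\<lambda>x. ennreal (gauss n \<theta> v x))"
proof -
  interpret L: product_sigma_finite "\<lambda>_::nat. lborel :: real measure"
    by standard
  interpret G: product_prob_space "\<lambda>i. glaw (\<theta> i) v"
    by (simp add: product_prob_space_def product_prob_space_axioms_def product_sigma_finite_def
        prob_space_glaw v prob_space_imp_sigma_finite)
  have "density (Rn n) (\<lambda>x. ennreal (gauss n \<theta> v x)) = PiM {..<n} (\<lambda>i. glaw (\<theta> i) v)"
  proof (rule G.PiM_eqI)
    show "sets (density (Rn n) (\<lambda>x. ennreal (gauss n \<theta> v x))) = sets (PiM {..<n} (\<lambda>i. glaw (\<theta> i) v))"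
      by (simp add: Rn_def cong: sets_PiM_cong)
    fix A assume A: "\<And>i. i \<in> {..<n} \<Longrightarrow> A i \<in> sets (glaw (\<theta> i) v)"
    have A': "A i \<in> sets borel" if "i < n" for i
      using A that by simp
    have PA: "Pi\<^sub>E {..<n} A \<in> sets (Rn n)"
      using A' unfolding Rn_def by (intro sets_PiM_I_finite) auto
    have "emeasure (density (Rn n) (\<lambda>x. ennreal (gauss n \<theta> v x))) (Pi\<^sub>E {..<n} A)
        = (\<integral>\<^sup>+ x. ennreal (gauss n \<theta> v x) * indicator (Pi\<^sub>E {..<n} A) x \<partial>Rn n)"
      using PA by (subst emeasure_density) auto
    also have "\<dots> = (\<integral>\<^sup>+ x. (\<Prod>i<n. ennreal (gauss1 (\<theta> i) v (x i)) * indicator (A i) (x i)) \<partial>Rn n)"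
    proof (rule nn_integral_cong)
      fix x assume "x \<in> space (Rn n)"
      then have "indicator (Pi\<^sub>E {..<n} A) x = (\<Prod>i<n. indicator (A i) (x i) :: ennreal)"
        by (auto simp: space_Rn indicator_def PiE_def Pi_def prod.neutral intro!: prod_zero)
      then show "ennreal (gauss n \<theta> v x) * indicator (Pi\<^sub>E {..<n} A) x
          = (\<Prod>i<n. ennreal (gauss1 (\<theta> i) v (x i)) * indicator (A i) (x i))"
        by (simp add: gauss_def prod.distrib prod_ennreal)
    qed
    also have "\<dots> = (\<Prod>i<n. \<integral>\<^sup>+ t. ennreal (gauss1 (\<theta> i) v t) * indicator (A i) t \<partial>lborel)"
      using A' unfolding Rn_def by (intro L.product_nn_integral_prod) auto
    also have "\<dots> = (\<Prod>i<n. emeasure (glaw (\<theta> i) v) (A i))"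
      using A' unfolding glaw_def by (intro prod.cong refl, subst emeasure_density) auto
    finally show "emeasure (density (Rn n) (\<lambda>x. ennreal (gauss n \<theta> v x))) (Pi\<^sub>E {..<n} A)
        = (\<Prod>i<n. emeasure (glaw (\<theta> i) v) (A i))" .
  qed simp
  then show ?thesis
    by (simp add: gauss_law_def)
qed

lemma prob_space_gauss_law: "0 < v \<Longrightarrow> prob_space (gauss_law n \<theta> v)"
  unfolding gauss_law_def by (intro prob_space_PiM prob_space_glaw)

lemma sets_gauss_law [measurable_cong, simp]: "sets (gauss_law n \<theta> v) = sets (Rn n)"
  and space_gauss_law [simp]: "space (gauss_law n \<theta> v) = space (Rn n)"
  unfolding gauss_law_def Rn_def by (auto simp: space_PiM intro!: sets_PiM_cong)

lemma gauss_law_coord: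
  assumes "0 < v" "i < n" "has_bochner_integral (glaw (\<theta> i) v) h (c :: real)"
  shows "has_bochner_integral (gauss_law n \<theta> v) (\<lambda>x. h (x i)) c"
proof -
  have d: "distr (gauss_law n \<theta> v) (glaw (\<theta> i) v) (\<lambda>x. x i) = glaw (\<theta> i) v"
    unfolding gauss_law_def
    by (rule distr_PiM_component [of "{..<n}" "\<lambda>i. glaw (\<theta> i) v"])
       (use assms in \<open>auto simp: prob_space_glaw\<close>)
  have m: "(\<lambda>x. x i) \<in> measurable (gauss_law n \<theta> v) (glaw (\<theta> i) v)"
    unfolding gauss_law_def using assms by (intro measurable_component_singleton) auto
  have h: "h \<in> borel_measurable (glaw (\<theta> i) v)"
    using assms by (auto simp: has_bochner_integral_iff)
  show ?thesis
    using assms(3) integrable_distr_eq[OF m h] integral_distr[OF m h]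
    by (simp add: has_bochner_integral_iff d)
qed

lemma has_bochner_integral_gauss_law_iff:
  assumes "0 < v" "f \<in> borel_measurable (Rn n)"
  shows "has_bochner_integral (gauss_law n \<theta> v) f (c :: real) \<longleftrightarrow>
    has_bochner_integral (Rn n) (\<lambda>x. gauss n \<theta> v x * f x) c"
  unfolding gauss_law_eq_density[OF assms(1)] has_bochner_integral_iff
  using assms by (simp add: integrable_density integral_density)

section \<open>Integrals of extended real functions\<close>

text \<open>Monotonicity and the value on integrable real functions reduce the loss and the risk to real
  integrals. Monotonicity also holds for non-measurable functions, so it applies to the loss as a
  function of \<open>x\<close>.\<close>

lemma ereal_integral_mono_AE:
  assumes "AE x in M. f x \<le> g x"
  shows "ereal_integral M f \<le> ereal_integral M g"
proof -
  have "(\<integral>\<^sup>+ x. e2ennreal (f x) \<partial>M) \<le> (\<integral>\<^sup>+ x. e2ennreal (g x) \<partial>M)"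
    using assms by (intro nn_integral_mono_AE) (auto elim!: eventually_mono intro: e2ennreal_mono)
  moreover have "(\<integral>\<^sup>+ x. e2ennreal (- g x) \<partial>M) \<le> (\<integral>\<^sup>+ x. e2ennreal (- f x) \<partial>M)"
    using assms by (intro nn_integral_mono_AE) (auto elim!: eventually_mono intro: e2ennreal_mono)
  ultimately show ?thesis
    unfolding ereal_integral_def by (intro ereal_minus_mono) (simp_all add: less_eq_ennreal.rep_eq)
qed

lemma ereal_integral_real:
  assumes "has_bochner_integral M f c"
  shows "ereal_integral M (\<lambda>x. ereal (f x)) = ereal c"
proof -
  have int: "integrable M f" and c: "c = integral\<^sup>L M f"
    using assms by (auto simp: has_bochner_integral_iff)
  have fin: "(\<integral>\<^sup>+ x. ennreal (f x) \<partial>M) \<noteq> \<infinity>" "(\<integral>\<^sup>+ x. ennreal (- f x) \<partial>M) \<noteq> \<infinity>"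
    using int by (auto simp: real_integrable_def)
  have "enn2ereal a = ereal (enn2real a)" if "a \<noteq> \<infinity>" for a
    using that by (cases a) auto
  then show ?thesis
    using fin by (simp add: ereal_integral_def c real_lebesgue_integral_def[OF int])
qed

section \<open>The risk of product estimators\<close>

text \<open>A certificate for an upper bound of the univariate risk: a majorant \<open>h\<close> of the log ratio,
  integrated over \<open>y\<close> to \<open>b\<close>, and a majorant \<open>B\<close> of \<open>b\<close>, integrated over \<open>x\<close> to \<open>R'\<close>. Working with
  majorants avoids proving that the log ratio and the loss are themselves integrable.\<close>

definition risk1_le :: "real \<Rightarrow> (real \<Rightarrow> real \<Rightarrow> real) \<Rightarrow> real \<Rightarrow> real \<Rightarrow> bool" where
  "risk1_le r q \<theta> R \<longleftrightarrow>
     (\<exists>h b B R'. (\<forall>x y. ln (gauss1 \<theta> r y / q x y) \<le> h x y) \<and>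
        (\<forall>x. has_bochner_integral (glaw \<theta> r) (h x) (b x)) \<and> (\<forall>x. b x \<le> B x) \<and>
        has_bochner_integral (glaw \<theta> 1) B R' \<and> R' \<le> R)"

text \<open>The logarithm turns the product into a sum of functions of single coordinates, so both
  integrals reduce to univariate ones.\<close>

lemma risk_product_le:
  assumes r: "0 < r" and q: "\<And>x y. 0 < q x y"
    and R: "\<And>i. i < n \<Longrightarrow> risk1_le r q (\<theta> i) (R i)"
  shows "risk n r \<theta> (\<lambda>x y. \<Prod>i<n. q (x i) (y i)) \<le> ereal (\<Sum>i<n. R i)"
proof -
  have "\<forall>i\<in>{..<n}. \<exists>h b B R'. (\<forall>x y. ln (gauss1 (\<theta> i) r y / q x y) \<le> h x y) \<and>
        (\<forall>x. has_bochner_integral (glaw (\<theta> i) r) (h x) (b x)) \<and> (\<forall>x. b x \<le> B x) \<and>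
        has_bochner_integral (glaw (\<theta> i) 1) B R' \<and> R' \<le> R i"
    using R by (simp add: risk1_le_def)
  then obtain h b B R' where hb: "\<forall>i\<in>{..<n}. (\<forall>x y. ln (gauss1 (\<theta> i) r y / q x y) \<le> h i x y) \<and>
        (\<forall>x. has_bochner_integral (glaw (\<theta> i) r) (h i x) (b i x)) \<and> (\<forall>x. b i x \<le> B i x) \<and>
        has_bochner_integral (glaw (\<theta> i) 1) (B i) (R' i) \<and> R' i \<le> R i"
    by (simp only: bchoice_iff) blast
  have h: "ln (gauss1 (\<theta> i) r y / q x y) \<le> h i x y"
    and b: "has_bochner_integral (glaw (\<theta> i) r) (h i x) (b i x)"
    and B: "b i x \<le> B i x"
    and R': "has_bochner_integral (glaw (\<theta> i) 1) (B i) (R' i)" "R' i \<le> R i"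
    if "i < n" for i x y
    using bspec[OF hb, of i] that by simp_all
  have transfer: "has_bochner_integral (Rn n) (\<lambda>x. gauss n \<theta> v x * (\<Sum>i<n. k i (x i))) (\<Sum>i<n. c i)"
    if "0 < v" "\<And>i. i < n \<Longrightarrow> has_bochner_integral (glaw (\<theta> i) v) (k i) (c i)" for v k c
  proof -
    have *: "has_bochner_integral (gauss_law n \<theta> v) (\<lambda>x. \<Sum>i<n. k i (x i)) (\<Sum>i<n. c i)"
      using that by (intro has_bochner_integral_sum gauss_law_coord) auto
    then have "(\<lambda>x. \<Sum>i<n. k i (x i)) \<in> borel_measurable (gauss_law n \<theta> v)"
      by (auto simp: has_bochner_integral_iff)
    then have "(\<lambda>x. \<Sum>i<n. k i (x i)) \<in> borel_measurable (Rn n)"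
      by (simp cong: measurable_cong_sets)
    then show ?thesis
      using has_bochner_integral_gauss_law_iff[OF that(1)] * by blast
  qed
  have KL: "KL_loss n r \<theta> (\<lambda>y. \<Prod>i<n. q (x i) (y i)) \<le> ereal (\<Sum>i<n. B i (x i))" for x
  proof -
    have pt: "(if (\<Prod>i<n. q (x i) (y i)) = 0 then \<infinity>
        else ereal (gauss n \<theta> r y * ln (gauss n \<theta> r y / (\<Prod>i<n. q (x i) (y i)))))
      \<le> ereal (gauss n \<theta> r y * (\<Sum>i<n. h i (x i) (y i)))" for y
    proof -
      have "ln (gauss n \<theta> r y / (\<Prod>i<n. q (x i) (y i)))
          = ln (\<Prod>i<n. gauss1 (\<theta> i) r (y i) / q (x i) (y i))"
        by (simp add: gauss_def prod_dividef)
      also have "\<dots> = (\<Sum>i<n. ln (gauss1 (\<theta> i) r (y i) / q (x i) (y i)))"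
        using q gauss1_pos[OF r] by (intro ln_prod) (auto simp: less_imp_neq[symmetric])
      also have "\<dots> \<le> (\<Sum>i<n. h i (x i) (y i))"
        using h by (intro sum_mono) auto
      finally have "gauss n \<theta> r y * ln (gauss n \<theta> r y / (\<Prod>i<n. q (x i) (y i)))
          \<le> gauss n \<theta> r y * (\<Sum>i<n. h i (x i) (y i))"
        by (intro mult_left_mono) simp_all
      moreover have "(\<Prod>i<n. q (x i) (y i)) \<noteq> 0"
        using q by (simp add: less_imp_neq[symmetric])
      ultimately show ?thesis
        by simp
    qed
    have "KL_loss n r \<theta> (\<lambda>y. \<Prod>i<n. q (x i) (y i))
        \<le> ereal_integral (Rn n) (\<lambda>y. ereal (gauss n \<theta> r y * (\<Sum>i<n. h i (x i) (y i))))"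
      unfolding KL_loss_def using pt by (intro ereal_integral_mono_AE AE_I2)
    also have "\<dots> = ereal (\<Sum>i<n. b i (x i))"
      using b by (intro ereal_integral_real transfer r)
    also have "\<dots> \<le> ereal (\<Sum>i<n. B i (x i))"
      using B by (auto intro!: sum_mono)
    finally show ?thesis .
  qed
  have "risk n r \<theta> (\<lambda>x y. \<Prod>i<n. q (x i) (y i))
      \<le> ereal_integral (Rn n) (\<lambda>x. ereal (gauss n \<theta> 1 x * (\<Sum>i<n. B i (x i))))"
    unfolding risk_def
  proof (intro ereal_integral_mono_AE AE_I2)
    fix x
    have "KL_loss n r \<theta> (\<lambda>y. \<Prod>i<n. q (x i) (y i)) * ereal (gauss n \<theta> 1 x)
        \<le> ereal (\<Sum>i<n. B i (x i)) * ereal (gauss n \<theta> 1 x)"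
      by (intro ereal_mult_right_mono KL) simp
    then show "KL_loss n r \<theta> (\<lambda>y. \<Prod>i<n. q (x i) (y i)) * ereal (gauss n \<theta> 1 x)
        \<le> ereal (gauss n \<theta> 1 x * (\<Sum>i<n. B i (x i)))"
      by (simp add: mult.commute)
  qed
  also have "\<dots> = ereal (\<Sum>i<n. R' i)"
    using R'(1) by (intro ereal_integral_real transfer) auto
  also have "\<dots> \<le> ereal (\<Sum>i<n. R i)"
    using R'(2) by (auto intro!: sum_mono)
  finally show ?thesis .
qed

section \<open>A variational lower bound for the risk\<close>

lemma has_bochner_integral_pair_mult:
  fixes f :: "'a \<Rightarrow> real" and g :: "'b \<Rightarrow> real"
  assumes "sigma_finite_measure M" "sigma_finite_measure N"
    and f: "has_bochner_integral M f a" and g: "has_bochner_integral N g b"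
  shows "has_bochner_integral (M \<Otimes>\<^sub>M N) (\<lambda>(x, y). f x * g y) (a * b)"
proof -
  interpret pair_sigma_finite M N
    using assms by (simp add: pair_sigma_finite_def)
  have [measurable]: "f \<in> borel_measurable M" "g \<in> borel_measurable N"
    using f g by (auto simp: has_bochner_integral_iff)
  have int: "integrable (M \<Otimes>\<^sub>M N) (\<lambda>(x, y). f x * g y)"
    using f g by (intro Fubini_integrable) (auto simp: has_bochner_integral_iff abs_mult)
  have "integral\<^sup>L (M \<Otimes>\<^sub>M N) (\<lambda>(x, y). f x * g y) = (\<integral>x. (\<integral>y. f x * g y \<partial>N) \<partial>M)"
    using integral_fst'[OF int] by simp
  also have "\<dots> = a * b"
    using f g by (simp add: has_bochner_integral_iff)
  finally show ?thesis
    using int by (simp add: has_bochner_integral_iff)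
qed

definition joint_law :: "nat \<Rightarrow> real \<Rightarrow> (nat \<Rightarrow> real) \<Rightarrow> ((nat \<Rightarrow> real) \<times> (nat \<Rightarrow> real)) measure" where
  "joint_law n r \<theta> = gauss_law n \<theta> 1 \<Otimes>\<^sub>M gauss_law n \<theta> r"

lemma sets_joint_law [measurable_cong, simp]: "sets (joint_law n r \<theta>) = sets (Rn n \<Otimes>\<^sub>M Rn n)"
  unfolding joint_law_def by (intro sets_pair_measure_cong) auto

lemma joint_law_coord:
  assumes "0 < r" "i < n" "has_bochner_integral (glaw (\<theta> i) 1) f (a :: real)"
    "has_bochner_integral (glaw (\<theta> i) r) g (b :: real)"
  shows "has_bochner_integral (joint_law n r \<theta>) (\<lambda>(x, y). f (x i) * g (y i)) (a * b)"
  unfolding joint_law_def using assms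
  by (intro has_bochner_integral_pair_mult gauss_law_coord)
    (auto intro!: prob_space_imp_sigma_finite prob_space_gauss_law)

lemma joint_law_const:
  assumes "0 < r"
  shows "has_bochner_integral (joint_law n r \<theta>) (\<lambda>_. c :: real) c"
proof -
  interpret X: prob_space "gauss_law n \<theta> 1" by (rule prob_space_gauss_law) simp
  interpret Y: prob_space "gauss_law n \<theta> r" by (rule prob_space_gauss_law) fact
  interpret pair_prob_space "gauss_law n \<theta> 1" "gauss_law n \<theta> r" ..
  show ?thesis
    unfolding joint_law_def using prob_space by (simp add: has_bochner_integral_iff)
qed

lemma joint_law_eq_density:
  assumes "0 < r"
  shows "joint_law n r \<theta> =
    density (Rn n \<Otimes>\<^sub>M Rn n) (\<lambda>(x, y). ennreal (gauss n \<theta> 1 x * gauss n \<theta> r y))"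
proof -
  have "joint_law n r \<theta> = density (Rn n \<Otimes>\<^sub>M Rn n)
      (\<lambda>(x, y). ennreal (gauss n \<theta> 1 x) * ennreal (gauss n \<theta> r y))"
    unfolding joint_law_def gauss_law_eq_density[OF assms] gauss_law_eq_density[OF zero_less_one]
    using assms by (intro pair_measure_density sigma_finite_Rn)
      (auto simp flip: gauss_law_eq_density intro!: prob_space_imp_sigma_finite prob_space_gauss_law)
  then show ?thesis
    by (simp add: ennreal_mult)
qed

text \<open>The likelihood ratio behind the reduction of predictive risk to a divergence for the pair \<open>(x, y)\<close>.\<close>

lemma gauss_shift:
  "gauss n (\<lambda>_. 0) 1 x = gauss n \<theta> 1 x * exp ((\<Sum>i<n. (\<theta> i)\<^sup>2) / 2 - (\<Sum>i<n. \<theta> i * x i))"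
proof -
  have "gauss1 0 1 t = gauss1 \<mu> 1 t * exp (\<mu>\<^sup>2 / 2 - \<mu> * t)" for \<mu> t
    by (simp add: gauss1_eq power2_eq_square field_simps flip: exp_add)
  then have "gauss n (\<lambda>_. 0) 1 x = (\<Prod>i<n. gauss1 (\<theta> i) 1 (x i) * exp ((\<theta> i)\<^sup>2 / 2 - \<theta> i * x i))"
    unfolding gauss_def by (intro prod.cong) auto
  also have "\<dots> = gauss n \<theta> 1 x * exp (\<Sum>i<n. (\<theta> i)\<^sup>2 / 2 - \<theta> i * x i)"
    by (simp add: gauss_def prod.distrib exp_sum)
  finally show ?thesis
    by (simp add: sum_subtractf sum_divide_distrib)
qed

text \<open>Pointwise form of the variational (Donsker--Varadhan) bound: \<open>a ln (a / c) \<ge> a - c\<close> with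
  \<open>c = b exp G\<close>.\<close>

lemma mult_ln_ratio_ge:
  fixes a b G :: real
  assumes "0 < a" "0 < b"
  shows "a * (1 + G) - b * exp G \<le> a * ln (a / b)"
proof -
  have "ln (b * exp G / a) \<le> b * exp G / a - 1"
    using assms by (intro ln_le_minus_one) auto
  then have "1 + G - b * exp G / a \<le> ln (a / b)"
    using assms by (simp add: ln_div ln_mult)
  then have "a * (1 + G - b * exp G / a) \<le> a * ln (a / b)"
    using assms by (intro mult_left_mono) auto
  then show ?thesis
    using assms by (simp add: algebra_simps)
qed

text \<open>Any predictive density extends the standard Gaussian law of \<open>x\<close> to a probability density of \<open>(x, y)\<close>.\<close>

lemma predictive_density_total:
  assumes p: "predictive_density n p"
  shows "has_bochner_integral (Rn n \<Otimes>\<^sub>M Rn n) (\<lambda>(x, y). gauss n (\<lambda>_. 0) 1 x * p x y) 1"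
proof -
  interpret sigma_finite_measure "Rn n" by (rule sigma_finite_Rn)
  have p_meas[measurable]: "(\<lambda>(x, y). p x y) \<in> borel_measurable (Rn n \<Otimes>\<^sub>M Rn n)"
    and p0: "\<And>x y. x \<in> space (Rn n) \<Longrightarrow> y \<in> space (Rn n) \<Longrightarrow> 0 \<le> p x y"
    and p1: "\<And>x. x \<in> space (Rn n) \<Longrightarrow> (\<integral>\<^sup>+ y. ennreal (p x y) \<partial>Rn n) = 1"
    using p by (auto simp: predictive_density_def)
  have [measurable]: "(\<lambda>z. p (fst z) (snd z)) \<in> borel_measurable (Rn n \<Otimes>\<^sub>M Rn n)"
    using p_meas by (simp add: split_beta)
  have "(\<integral>\<^sup>+ z. ennreal (gauss n (\<lambda>_. 0) 1 (fst z) * p (fst z) (snd z)) \<partial>(Rn n \<Otimes>\<^sub>M Rn n))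
      = (\<integral>\<^sup>+ x. \<integral>\<^sup>+ y. ennreal (gauss n (\<lambda>_. 0) 1 x * p x y) \<partial>Rn n \<partial>Rn n)"
    by (subst nn_integral_fst[symmetric]) auto
  also have "\<dots> = (\<integral>\<^sup>+ x. ennreal (gauss n (\<lambda>_. 0) 1 x) \<partial>Rn n)"
  proof (rule nn_integral_cong)
    fix x assume x: "x \<in> space (Rn n)"
    have [measurable]: "(\<lambda>y. p x y) \<in> borel_measurable (Rn n)"
      using measurable_Pair2[OF p_meas x] by simp
    have "(\<integral>\<^sup>+ y. ennreal (gauss n (\<lambda>_. 0) 1 x * p x y) \<partial>Rn n)
        = (\<integral>\<^sup>+ y. ennreal (gauss n (\<lambda>_. 0) 1 x) * ennreal (p x y) \<partial>Rn n)"
      using p0[OF x] by (intro nn_integral_cong) (simp add: ennreal_mult)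
    then show "(\<integral>\<^sup>+ y. ennreal (gauss n (\<lambda>_. 0) 1 x * p x y) \<partial>Rn n)
        = ennreal (gauss n (\<lambda>_. 0) 1 x)"
      using p1[OF x] by (simp add: nn_integral_cmult)
  qed
  also have "\<dots> = 1"
  proof -
    interpret P: prob_space "gauss_law n (\<lambda>_. 0) 1" by (rule prob_space_gauss_law) simp
    show ?thesis
      using P.emeasure_space_1 by (simp add: gauss_law_eq_density emeasure_density cong: nn_integral_cong)
  qed
  finally have "has_bochner_integral (Rn n \<Otimes>\<^sub>M Rn n)
      (\<lambda>z. gauss n (\<lambda>_. 0) 1 (fst z) * p (fst z) (snd z)) 1"
    by (intro has_bochner_integral_nn_integral AE_I2) (auto simp: p0 space_pair_measure)
  then show ?thesis 
    by (simp add: split_beta')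
qed

lemma predictive_density_integrable:
  assumes p: "predictive_density n p" and g: "g \<in> borel_measurable (Rn n \<Otimes>\<^sub>M Rn n)"
    and C: "\<And>z. g z \<le> C"
  shows "integrable (Rn n \<Otimes>\<^sub>M Rn n) (\<lambda>(x, y). gauss n (\<lambda>_. 0) 1 x * p x y * exp (g (x, y)))"
proof -
  note g[measurable]
  have [measurable]: "(\<lambda>z. p (fst z) (snd z)) \<in> borel_measurable (Rn n \<Otimes>\<^sub>M Rn n)"
    using p by (simp add: predictive_density_def split_beta')
  have "integrable (Rn n \<Otimes>\<^sub>M Rn n) (\<lambda>z. exp C * (gauss n (\<lambda>_. 0) 1 (fst z) * p (fst z) (snd z)))"
    using predictive_density_total[OF p] by (intro integrable_mult_right) (auto simp: has_bochner_integral_iff split_beta')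
  then show ?thesis 
  proof (rule Bochner_Integration.integrable_bound)
    show "AE z in Rn n \<Otimes>\<^sub>M Rn n.
        norm (case z of (x, y) \<Rightarrow> gauss n (\<lambda>_. 0) 1 x * p x y * exp (g (x, y)))
        \<le> norm (exp C * (gauss n (\<lambda>_. 0) 1 (fst z) * p (fst z) (snd z)))"
    proof (rule AE_I2)
      fix z assume "z \<in> space (Rn n \<Otimes>\<^sub>M Rn n)"
      have "\<bar>gauss n (\<lambda>_. 0) 1 (fst z) * p (fst z) (snd z)\<bar> * exp (g z)
          \<le> \<bar>gauss n (\<lambda>_. 0) 1 (fst z) * p (fst z) (snd z)\<bar> * exp C"
        using C by (intro mult_left_mono) auto
      then show "norm (case z of (x, y) \<Rightarrow> gauss n (\<lambda>_. 0) 1 x * p x y * exp (g (x, y)))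
          \<le> norm (exp C * (gauss n (\<lambda>_. 0) 1 (fst z) * p (fst z) (snd z)))"
        by (simp add: split_beta abs_mult mult_ac)
    qed
  qed measurable
qed

text \<open>With \<open>Q\<close> the law with density \<open>gauss n 0 1 x * p x y\<close>, the risk plus \<open>\<bar>\<theta>\<bar>\<^sup>2 / 2\<close> is the divergence
  of the joint law from \<open>Q\<close>, which is at least the expectation of \<open>g\<close>, plus \<open>1\<close>, minus the \<open>Q\<close>-integral
  of \<open>exp g\<close>. The upper bound \<open>C\<close> makes that last integral finite for every \<open>p\<close>. The argument is
  carried out under the integral sign, with \<open>G\<close> the test function \<open>g\<close> corrected by the
  log-likelihood ratio of \<open>x\<close>, because the loss may be infinite.\<close>

lemma risk_ge:
  assumes r: "0 < r" and p: "predictive_density n p"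
    and g_int: "has_bochner_integral (joint_law n r \<theta>) g c" and C: "\<And>z. g z \<le> C"
  shows "ereal (1 + c - (\<Sum>i<n. (\<theta> i)\<^sup>2) / 2 -
      (\<integral>(x, y). gauss n (\<lambda>_. 0) 1 x * p x y * exp (g (x, y)) \<partial>(Rn n \<Otimes>\<^sub>M Rn n))) \<le> risk n r \<theta> p"
proof -
  interpret R: sigma_finite_measure "Rn n" by (rule sigma_finite_Rn)
  interpret pair_sigma_finite "Rn n" "Rn n" ..
  define T where "T = (\<Sum>i<n. (\<theta> i)\<^sup>2) / 2"
  define G where "G = (\<lambda>x y. g (x, y) - (\<Sum>i<n. \<theta> i * x i) + T)"
  define H where "H = (\<lambda>x y. gauss n \<theta> 1 x * gauss n \<theta> r y * (1 + G x y)
      - gauss n (\<lambda>_. 0) 1 x * p x y * exp (g (x, y)))"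
  define W where "W = 1 + c - (\<Sum>i<n. (\<theta> i)\<^sup>2) / 2 -
      (\<integral>(x, y). gauss n (\<lambda>_. 0) 1 x * p x y * exp (g (x, y)) \<partial>(Rn n \<Otimes>\<^sub>M Rn n))"
  have g[measurable]: "g \<in> borel_measurable (Rn n \<Otimes>\<^sub>M Rn n)"
    using g_int by (auto simp: has_bochner_integral_iff cong: measurable_cong_sets)
  have lin: "has_bochner_integral (joint_law n r \<theta>) (\<lambda>z. \<theta> i * fst z i) (\<theta> i * \<theta> i)" if "i < n" for i
  proof -
    have "has_bochner_integral (glaw (\<theta> i) 1) (\<lambda>x. (x - \<theta> i) + \<theta> i) (0 + \<theta> i)"
      by (intro has_bochner_integral_add glaw_centred glaw_const) auto
    then have "has_bochner_integral (joint_law n r \<theta>) (\<lambda>(x, y). x i * 1) (\<theta> i * 1)"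
      using that r by (intro joint_law_coord glaw_const) auto
    then show ?thesis
      by (intro has_bochner_integral_mult_right) (simp add: split_beta')
  qed
  have "has_bochner_integral (joint_law n r \<theta>) (\<lambda>z. 1 + (g z - (\<Sum>i<n. \<theta> i * fst z i) + T))
      (1 + (c - (\<Sum>i<n. \<theta> i * \<theta> i) + T))"
    by (intro has_bochner_integral_add has_bochner_integral_diff has_bochner_integral_sum
        joint_law_const r g_int lin) auto
  moreover have "1 + (c - (\<Sum>i<n. \<theta> i * \<theta> i) + T) = 1 + c - T"
    by (simp add: T_def power2_eq_square)
  ultimately have J: "has_bochner_integral (joint_law n r \<theta>) (\<lambda>(x, y). 1 + G x y) (1 + c - T)"
    by (simp add: G_def split_beta')
  then have [measurable]: "(\<lambda>(x, y). 1 + G x y) \<in> borel_measurable (Rn n \<Otimes>\<^sub>M Rn n)"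
    by (auto simp: has_bochner_integral_iff cong: measurable_cong_sets)
  have "has_bochner_integral (Rn n \<Otimes>\<^sub>M Rn n)
      (\<lambda>(x, y). gauss n \<theta> 1 x * gauss n \<theta> r y * (1 + G x y)) (1 + c - T)"
    using J unfolding joint_law_eq_density[OF r] has_bochner_integral_iff split_beta'
    by (subst (asm) integrable_density, simp, simp, simp,
        subst (asm) integral_density, simp_all add: split_beta')
  then have "has_bochner_integral (Rn n \<Otimes>\<^sub>M Rn n) (\<lambda>(x, y). H x y) W"
    using predictive_density_integrable[OF p g C]
    unfolding W_def T_def H_def split_beta' by (intro has_bochner_integral_diff)
      (auto simp: split_beta' has_bochner_integral_iff)
  then have H: "integrable (Rn n \<Otimes>\<^sub>M Rn n) (\<lambda>(x, y). H x y)"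
    and HW: "integral\<^sup>L (Rn n \<Otimes>\<^sub>M Rn n) (\<lambda>(x, y). H x y) = W"
    by (auto simp: has_bochner_integral_iff)
  have fub: "has_bochner_integral (Rn n) (\<lambda>x. \<integral>y. H x y \<partial>Rn n) W"
    using integrable_fst'[OF H] integral_fst'[OF H] HW by (simp add: has_bochner_integral_iff)
  have "AE x in Rn n. integrable (Rn n) (\<lambda>y. H x y)"
    using AE_integrable_fst'[OF H] by simp
  then have le: "AE x in Rn n. ereal (\<integral>y. H x y \<partial>Rn n) \<le> KL_loss n r \<theta> (p x) * ereal (gauss n \<theta> 1 x)"
    using AE_space
  proof eventually_elim
    case (elim x)
    have pos: "0 < gauss n \<theta> 1 x"
      by (simp add: gauss_pos)
    have Hx: "H x y = gauss n \<theta> 1 x * (gauss n \<theta> r y * (1 + G x y) - p x y * exp (G x y))" for y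
    proof -
      have "gauss n (\<lambda>_. 0) 1 x * exp (g (x, y)) = gauss n \<theta> 1 x * exp (G x y)"
        by (subst gauss_shift[of n x \<theta>]) (simp add: G_def T_def algebra_simps flip: exp_add)
      then show ?thesis
        unfolding H_def by (simp add: algebra_simps)
    qed
    have "integrable (Rn n) (\<lambda>y. H x y / gauss n \<theta> 1 x)"
      using elim(1) by simp
    then have "has_bochner_integral (Rn n) (\<lambda>y. H x y / gauss n \<theta> 1 x)
        ((\<integral>y. H x y \<partial>Rn n) / gauss n \<theta> 1 x)"
      by (simp add: has_bochner_integral_iff)
    then have "ereal ((\<integral>y. H x y \<partial>Rn n) / gauss n \<theta> 1 x)
        = ereal_integral (Rn n) (\<lambda>y. ereal (H x y / gauss n \<theta> 1 x))"
      by (rule ereal_integral_real[symmetric])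
    also have "\<dots> \<le> KL_loss n r \<theta> (p x)"
      unfolding KL_loss_def
    proof (intro ereal_integral_mono_AE AE_I2)
      fix y assume y: "y \<in> space (Rn n)"
      have "0 \<le> p x y"
        using p elim(2) y by (auto simp: predictive_density_def)
      then show "ereal (H x y / gauss n \<theta> 1 x) \<le> (if p x y = 0 then \<infinity>
          else ereal (gauss n \<theta> r y * ln (gauss n \<theta> r y / p x y)))"
        using pos mult_ln_ratio_ge[of "gauss n \<theta> r y" "p x y" "G x y"] gauss_pos[OF r, of n \<theta> y]
        by (simp add: Hx)
    qed
    finally have "ereal ((\<integral>y. H x y \<partial>Rn n) / gauss n \<theta> 1 x) * ereal (gauss n \<theta> 1 x)
        \<le> KL_loss n r \<theta> (p x) * ereal (gauss n \<theta> 1 x)"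
      by (intro ereal_mult_right_mono) simp_all
    then show ?case
      using pos by simp
  qed
  have "ereal W = ereal_integral (Rn n) (\<lambda>x. ereal (\<integral>y. H x y \<partial>Rn n))"
    using fub by (rule ereal_integral_real[symmetric])
  also have "\<dots> \<le> risk n r \<theta> p"
    unfolding risk_def by (rule ereal_integral_mono_AE[OF le])
  finally show ?thesis
    by (simp add: W_def)
qed

section \<open>The lower bound on the minimax risk\<close>

lemma v_w_eq: "0 < r \<Longrightarrow> v_w r = r / (1 + r)"
  by (simp add: v_w_def field_simps)

lemma v_w_pos: "0 < r \<Longrightarrow> 0 < v_w r"
  by (simp add: v_w_eq)

text \<open>The sufficient statistic for \<open>\<theta> i\<close> given both observations; it is normal with variance \<open>v_w r\<close>, as
  its exponential moments below show.\<close>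

definition pooled :: "real \<Rightarrow> nat \<Rightarrow> (nat \<Rightarrow> real) \<times> (nat \<Rightarrow> real) \<Rightarrow> real" where
  "pooled r i z = (r * fst z i + snd z i) / (1 + r)"

lemma pooled_exp:
  assumes r: "0 < r" and i: "i < n"
  shows "has_bochner_integral (joint_law n r \<theta>) (\<lambda>z. exp (\<beta> * (pooled r i z - t)))
    (exp (\<beta> * (\<theta> i - t) + \<beta>\<^sup>2 * v_w r / 2))"
proof -
  define a where "a = \<beta> * r / (1 + r)"
  define b where "b = \<beta> / (1 + r)"
  have "has_bochner_integral (joint_law n r \<theta>) (\<lambda>(x, y). exp (a * x i) * exp (b * y i))
      (exp (a * \<theta> i + a\<^sup>2 * 1 / 2) * exp (b * \<theta> i + b\<^sup>2 * r / 2))"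
    using r i by (intro joint_law_coord glaw_exp) auto
  then have *: "has_bochner_integral (joint_law n r \<theta>)
      (\<lambda>z. exp (- \<beta> * t) * (exp (a * fst z i) * exp (b * snd z i)))
      (exp (- \<beta> * t) * (exp (a * \<theta> i + a\<^sup>2 * 1 / 2) * exp (b * \<theta> i + b\<^sup>2 * r / 2)))"
    by (intro has_bochner_integral_mult_right) (simp add: split_beta')
  have "exp (- \<beta> * t) * (exp (a * fst z i) * exp (b * snd z i)) = exp (\<beta> * (pooled r i z - t))" for z
  proof -
    have "\<beta> * (pooled r i z - t) = - \<beta> * t + (a * fst z i + b * snd z i)"
      by (simp add: a_def b_def pooled_def add_divide_distrib algebra_simps)
    then show ?thesis
      by (simp flip: exp_add)
  qed
  moreover have "exp (- \<beta> * t) * (exp (a * \<theta> i + a\<^sup>2 * 1 / 2) * exp (b * \<theta> i + b\<^sup>2 * r / 2))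
      = exp (\<beta> * (\<theta> i - t) + \<beta>\<^sup>2 * v_w r / 2)"
  proof -
    have "a + b = \<beta>"
    proof -
      have "a + b = \<beta> * (1 + r) / (1 + r)"
        by (simp add: a_def b_def add_divide_distrib algebra_simps)
      then show ?thesis
        using r by simp
    qed
    moreover have "a\<^sup>2 + b\<^sup>2 * r = \<beta>\<^sup>2 * v_w r"
    proof -
      have "a\<^sup>2 + b\<^sup>2 * r = \<beta>\<^sup>2 * (r * (1 + r)) / ((1 + r) * (1 + r))"
        using r unfolding a_def b_def by (simp add: power2_eq_square add_divide_distrib algebra_simps)
      then show ?thesis
        using r by (simp add: v_w_eq)
    qed
    ultimately have "\<beta> * (\<theta> i - t) + \<beta>\<^sup>2 * v_w r / 2 = - \<beta> * t + ((a + b) * \<theta> i + (a\<^sup>2 + b\<^sup>2 * r) / 2)"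
      by (simp add: algebra_simps)
    then show ?thesis
      by (simp add: algebra_simps add_divide_distrib flip: exp_add)
  qed
  ultimately show ?thesis
    using * by simp
qed

text \<open>A smooth lower estimate for the indicator that, in a block with pooled observations \<open>w\<close>, the place
  \<open>j\<close> is the only one where \<open>w\<close> exceeds \<open>t\<close>. The indicator of each way to fail is replaced by
  its exponential (Chernoff) majorant, whose expectation is explicit.\<close>

definition spike_score :: "nat \<Rightarrow> real \<Rightarrow> real \<Rightarrow> real \<Rightarrow> (nat \<Rightarrow> real) \<Rightarrow> nat \<Rightarrow> real" where
  "spike_score m t \<beta> \<gamma> w j =
     1 - exp (- \<beta> * (w j - t)) - (\<Sum>k\<in>{..<m} - {j}. exp (\<gamma> * (w k - t)))"

text \<open>At most one place of a block has a positive score, and its score is at most \<open>1\<close>. So exponentiating with a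
  factor \<open>L \<le> ln m\<close> gives one summand at most \<open>m\<close>, and all others at most \<open>1\<close>.\<close>

lemma sum_exp_spike_score:
  assumes "0 \<le> \<beta>" "0 \<le> \<gamma>" "0 \<le> L" "exp L \<le> real m"
  shows "(\<Sum>j<m. exp (L * spike_score m t \<beta> \<gamma> w j)) \<le> 2 * real m"
proof (cases "\<exists>j<m. w j > t")
  case True
  then obtain j0 where j0: "j0 < m" "w j0 > t"
    by blast
  have le0: "spike_score m t \<beta> \<gamma> w j \<le> 0" if "j \<noteq> j0" for j
  proof -
    have "exp (\<gamma> * (w j0 - t)) \<le> (\<Sum>k\<in>{..<m} - {j}. exp (\<gamma> * (w k - t)))"
      using that j0 by (intro member_le_sum) auto
    moreover have "1 \<le> exp (\<gamma> * (w j0 - t))"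
      using assms j0 by simp
    ultimately show ?thesis
      unfolding spike_score_def by (smt (verit) exp_gt_zero)
  qed
  have le1: "spike_score m t \<beta> \<gamma> w j0 \<le> 1"
    unfolding spike_score_def by (smt (verit) exp_gt_zero sum_nonneg)
  have "(\<Sum>j<m. exp (L * spike_score m t \<beta> \<gamma> w j))
      = exp (L * spike_score m t \<beta> \<gamma> w j0) + (\<Sum>j\<in>{..<m} - {j0}. exp (L * spike_score m t \<beta> \<gamma> w j))"
    using j0 by (subst sum.remove[of _ j0]) auto
  also have "\<dots> \<le> exp L + (\<Sum>j\<in>{..<m} - {j0}. 1)"
  proof (intro add_mono sum_mono)
    show "exp (L * spike_score m t \<beta> \<gamma> w j0) \<le> exp L"
      using le1 assms mult_left_mono[of _ 1 L] by simp
    show "exp (L * spike_score m t \<beta> \<gamma> w j) \<le> 1" if "j \<in> {..<m} - {j0}" for j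
      using that le0[of j] assms by (simp add: mult_nonneg_nonpos)
  qed
  also have "\<dots> \<le> 2 * real m"
    using assms j0 by (simp add: of_nat_diff)
  finally show ?thesis .
next
  case False
  have "exp (L * spike_score m t \<beta> \<gamma> w j) \<le> 1" if "j < m" for j
  proof -
    have "\<beta> * (w j - t) \<le> 0"
      using False that assms by (intro mult_nonneg_nonpos) (meson diff_le_0_iff_le not_less)+
    then have "1 \<le> exp (- \<beta> * (w j - t))"
      by simp
    then have "spike_score m t \<beta> \<gamma> w j \<le> 0"
      unfolding spike_score_def by (smt (verit) exp_gt_zero sum_nonneg)
    then show ?thesis
      using assms by (simp add: mult_nonneg_nonpos)
  qed
  then have "(\<Sum>j<m. exp (L * spike_score m t \<beta> \<gamma> w j)) \<le> (\<Sum>j<m. 1)"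
    by (intro sum_mono) auto
  then show ?thesis
    by simp
qed

definition codewords :: "nat \<Rightarrow> nat \<Rightarrow> (nat \<Rightarrow> nat) set" where
  "codewords s m = ({..<s} \<rightarrow>\<^sub>E {..<m})"

definition spikes :: "nat \<Rightarrow> nat \<Rightarrow> nat \<Rightarrow> real \<Rightarrow> (nat \<Rightarrow> nat) \<Rightarrow> nat \<Rightarrow> real" where
  "spikes n s m \<mu> c = (\<lambda>i\<in>{..<n}. if i < s * m \<and> i mod m = c (i div m) then \<mu> else 0)"

lemma block_index_less:
  fixes b j m s :: nat
  assumes "b < s" "j < m"
  shows "b * m + j < s * m"
proof -
  have "b * m + j < Suc b * m"
    using assms by simp
  also have "\<dots> \<le> s * m"
    using assms by (intro mult_right_mono) auto
  finally show ?thesis .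
qed

lemma spikes_block:
  assumes "s * m \<le> n" "b < s" "j < m"
  shows "spikes n s m \<mu> c (b * m + j) = (if j = c b then \<mu> else 0)"
  using block_index_less[OF assms(2,3)] assms by (simp add: spikes_def)

lemma spikes_support:
  assumes "0 < m"
  shows "{i \<in> {..<n}. spikes n s m \<mu> c i \<noteq> 0} \<subseteq> (\<lambda>b. b * m + c b) ` {..<s}"
proof
  fix i assume "i \<in> {i \<in> {..<n}. spikes n s m \<mu> c i \<noteq> 0}"
  then have i: "i < s * m" "i mod m = c (i div m)"
    by (auto simp: spikes_def split: if_splits)
  then have "i div m < s"
    using assms by (simp add: less_mult_imp_div_less)
  moreover have "i = i div m * m + c (i div m)"
    using i(2) by (metis div_mult_mod_eq)
  ultimately show "i \<in> (\<lambda>b. b * m + c b) ` {..<s}"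
    by blast
qed

lemma card_spikes_support:
  assumes "0 < m"
  shows "card {i \<in> {..<n}. spikes n s m \<mu> c i \<noteq> 0} \<le> s"
  using card_mono[OF _ spikes_support[OF assms, of n s \<mu> c]]
    card_image_le[of "{..<s}" "\<lambda>b. b * m + c b"] by simp

lemma spikes_sparse: "0 < m \<Longrightarrow> spikes n s m \<mu> c \<in> sparse_vecs n s"
  using card_spikes_support[of m n s \<mu> c]
  unfolding sparse_vecs_def space_Rn by (auto simp: spikes_def extensional_def)

lemma sum_spikes_square:
  assumes "0 < m"
  shows "(\<Sum>i<n. (spikes n s m \<mu> c i)\<^sup>2) \<le> real s * \<mu>\<^sup>2"
proof -
  let ?S = "{i \<in> {..<n}. spikes n s m \<mu> c i \<noteq> 0}"
  have "(\<Sum>i<n. (spikes n s m \<mu> c i)\<^sup>2) = (\<Sum>i\<in>?S. (spikes n s m \<mu> c i)\<^sup>2)"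
    by (intro sum.mono_neutral_right) auto
  also have "\<dots> \<le> (\<Sum>i\<in>?S. \<mu>\<^sup>2)"
    by (intro sum_mono) (simp add: spikes_def)
  also have "\<dots> \<le> real s * \<mu>\<^sup>2"
    using card_spikes_support[OF assms, of n s \<mu> c] by (simp add: mult_right_mono)
  finally show ?thesis .
qed

text \<open>The test function adds \<open>L * spike_score\<close> over the blocks. Its exponential is a product over blocks, so
  the average over all codewords factorizes and is at most \<open>2 ^ s\<close> pointwise in \<open>(x, y)\<close>, whatever
  \<open>p\<close> is; the summand \<open>- s ln 2\<close> normalizes it to \<open>1\<close>. Hence some codeword has
  \<open>Q\<close>-integral at most \<open>1\<close>, and \<open>risk_ge\<close> applies to it. The two exponential terms are
  the Chernoff bounds for missing the spike and for a false spike.\<close>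

lemma minimax_risk_ge:
  assumes r: "0 < r" and m: "0 < m" and sm: "s * m \<le> n"
    and L: "0 \<le> L" "exp L \<le> real m" and t: "0 \<le> t" "t \<le> \<mu>"
  defines "v \<equiv> v_w r"
  shows "ereal (real s * (L * (1 - exp (- (\<mu> - t)\<^sup>2 / (2 * v)) - real m * exp (- t\<^sup>2 / (2 * v)))
      - ln 2 - \<mu>\<^sup>2 / 2)) \<le> minimax_risk n r (sparse_vecs n s)"
  unfolding minimax_risk_def
proof (rule INF_greatest)
  fix p assume "p \<in> {p. predictive_density n p}"
  then have p: "predictive_density n p"
    by simp
  have v: "0 < v"
    using r by (simp add: v_def v_w_pos)
  \<comment> \<open>These rates minimize the two Chernoff bounds.\<close>
  define \<beta> where "\<beta> = (\<mu> - t) / v"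
  define \<gamma> where "\<gamma> = t / v"
  have \<beta>\<gamma>: "0 \<le> \<beta>" "0 \<le> \<gamma>"
    using t v by (simp_all add: \<beta>_def \<gamma>_def)
  define w where "w = (\<lambda>z b j. pooled r (b * m + j) z)"
  define g where "g = (\<lambda>c z. (\<Sum>b<s. L * spike_score m t \<beta> \<gamma> (w z b) (c b)) - real s * ln 2)"
  define \<epsilon>1 where "\<epsilon>1 = exp (- (\<mu> - t)\<^sup>2 / (2 * v))"
  define \<epsilon>2 where "\<epsilon>2 = exp (- t\<^sup>2 / (2 * v))"
  define E where "E = real s * (L * (1 - \<epsilon>1 - real (m - 1) * \<epsilon>2)) - real s * ln 2"
  define Q where "Q = (\<lambda>z. gauss n (\<lambda>_. 0) 1 (fst z) * p (fst z) (snd z))"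
  have tilt: "exp ((a / v)\<^sup>2 * v / 2 - a * a / v) = exp (- a\<^sup>2 / (2 * v))" for a
    using v by (simp add: power2_eq_square field_simps)
  have g_int: "has_bochner_integral (joint_law n r (spikes n s m \<mu> c)) (g c) E"
    if c: "c \<in> codewords s m" for c
  proof -
    have cb: "c b < m" if "b < s" for b
      using c that by (auto simp: codewords_def)
    have hit: "has_bochner_integral (joint_law n r (spikes n s m \<mu> c))
        (\<lambda>z. exp (- \<beta> * (w z b (c b) - t))) \<epsilon>1" if "b < s" for b
    proof -
      have "has_bochner_integral (joint_law n r (spikes n s m \<mu> c))
          (\<lambda>z. exp (- \<beta> * (pooled r (b * m + c b) z - t)))
          (exp (- \<beta> * (spikes n s m \<mu> c (b * m + c b) - t) + (- \<beta>)\<^sup>2 * v_w r / 2))"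
        using block_index_less[OF that cb[OF that]] sm by (intro pooled_exp r) auto
      also have "exp (- \<beta> * (spikes n s m \<mu> c (b * m + c b) - t) + (- \<beta>)\<^sup>2 * v_w r / 2) = \<epsilon>1"
        using tilt[of "\<mu> - t"] spikes_block[OF sm that cb[OF that]]
        by (simp add: \<beta>_def \<epsilon>1_def v_def)
      finally show ?thesis
        by (simp add: w_def)
    qed
    have miss: "has_bochner_integral (joint_law n r (spikes n s m \<mu> c))
        (\<lambda>z. exp (\<gamma> * (w z b j - t))) \<epsilon>2" if "b < s" "j \<in> {..<m} - {c b}" for b j
    proof -
      have "has_bochner_integral (joint_law n r (spikes n s m \<mu> c))
          (\<lambda>z. exp (\<gamma> * (pooled r (b * m + j) z - t)))
          (exp (\<gamma> * (spikes n s m \<mu> c (b * m + j) - t) + \<gamma>\<^sup>2 * v_w r / 2))"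
        using block_index_less[of b s j m] that sm by (intro pooled_exp r) auto
      also have "exp (\<gamma> * (spikes n s m \<mu> c (b * m + j) - t) + \<gamma>\<^sup>2 * v_w r / 2) = \<epsilon>2"
        using tilt[of t] spikes_block[OF sm that(1), of j] that
        by (simp add: \<gamma>_def \<epsilon>2_def v_def)
      finally show ?thesis
        by (simp add: w_def)
    qed
    have "has_bochner_integral (joint_law n r (spikes n s m \<mu> c)) (g c)
        ((\<Sum>b<s. L * (1 - \<epsilon>1 - (\<Sum>j\<in>{..<m} - {c b}. \<epsilon>2))) - real s * ln 2)"
      unfolding g_def spike_score_def
      by (intro has_bochner_integral_diff has_bochner_integral_sum has_bochner_integral_mult_right
          joint_law_const r hit miss) auto
    also have "(\<Sum>b<s. L * (1 - \<epsilon>1 - (\<Sum>j\<in>{..<m} - {c b}. \<epsilon>2))) - real s * ln 2 = E"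
      using cb by (simp add: E_def)
    finally show ?thesis .
  qed
  have g_le: "g c z \<le> real s * L" for c z
  proof -
    have "spike_score m t \<beta> \<gamma> (w z b) (c b) \<le> 1" for b
      unfolding spike_score_def by (smt (verit) exp_gt_zero sum_nonneg)
    then have "(\<Sum>b<s. L * spike_score m t \<beta> \<gamma> (w z b) (c b)) \<le> (\<Sum>b<s. L * 1)"
      using L by (intro sum_mono mult_left_mono) auto
    then have "(\<Sum>b<s. L * spike_score m t \<beta> \<gamma> (w z b) (c b)) \<le> real s * L"
      by simp
    moreover have "0 \<le> real s * ln 2"
      by (intro mult_nonneg_nonneg) auto
    ultimately show ?thesis
      unfolding g_def by linarith
  qed
  have g_meas: "g c \<in> borel_measurable (Rn n \<Otimes>\<^sub>M Rn n)" if "c \<in> codewords s m" for c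
    using g_int[OF that] by (auto simp: has_bochner_integral_iff cong: measurable_cong_sets)
  have fin: "finite (codewords s m)"
    by (simp add: codewords_def finite_PiE)
  have ne: "(\<lambda>b\<in>{..<s}. 0) \<in> codewords s m"
    using m by (auto simp: codewords_def)
  have card: "real (card (codewords s m)) = real m ^ s"
    by (simp add: codewords_def card_PiE)
  have avg: "(\<Sum>c\<in>codewords s m. exp (g c z)) \<le> real m ^ s" for z
  proof -
    have "(\<Sum>c\<in>codewords s m. exp (g c z))
        = (\<Sum>c\<in>codewords s m. \<Prod>b<s. exp (L * spike_score m t \<beta> \<gamma> (w z b) (c b)) / 2)"
      by (intro sum.cong refl)
        (simp add: g_def exp_diff exp_sum prod_dividef exp_of_nat_mult)
    also have "\<dots> = (\<Prod>b<s. \<Sum>j<m. exp (L * spike_score m t \<beta> \<gamma> (w z b) j) / 2)"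
      unfolding codewords_def by (rule prod_sum_PiE[symmetric]) auto
    also have "\<dots> \<le> (\<Prod>b<s. real m)"
    proof (intro prod_mono conjI)
      show "(\<Sum>j<m. exp (L * spike_score m t \<beta> \<gamma> (w z b) j) / 2) \<le> real m" for b
        using sum_exp_spike_score[OF \<beta>\<gamma> L, of t "w z b"] by (simp flip: sum_divide_distrib)
    qed (simp add: sum_nonneg)
    finally show ?thesis
      by simp
  qed
  define A where "A = (\<lambda>c. \<integral>z. Q z * exp (g c z) \<partial>(Rn n \<Otimes>\<^sub>M Rn n))"
  have int: "integrable (Rn n \<Otimes>\<^sub>M Rn n) (\<lambda>z. Q z * exp (g c z))" if "c \<in> codewords s m" for c
    using predictive_density_integrable[OF p g_meas[OF that] g_le] by (simp add: Q_def split_beta')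
  have Q: "has_bochner_integral (Rn n \<Otimes>\<^sub>M Rn n) Q 1"
    using predictive_density_total[OF p] by (simp add: Q_def split_beta')
  have "(\<Sum>c\<in>codewords s m. A c)
      = (\<integral>z. (\<Sum>c\<in>codewords s m. Q z * exp (g c z)) \<partial>(Rn n \<Otimes>\<^sub>M Rn n))"
    unfolding A_def using int by (intro Bochner_Integration.integral_sum[symmetric]) auto
  also have "\<dots> \<le> (\<integral>z. Q z * real m ^ s \<partial>(Rn n \<Otimes>\<^sub>M Rn n))"
  proof (rule integral_mono)
    show "integrable (Rn n \<Otimes>\<^sub>M Rn n) (\<lambda>z. \<Sum>c\<in>codewords s m. Q z * exp (g c z))"
      using int by (intro Bochner_Integration.integrable_sum) auto
    show "integrable (Rn n \<Otimes>\<^sub>M Rn n) (\<lambda>z. Q z * real m ^ s)"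
      using Q by (simp add: has_bochner_integral_iff)
    fix z assume "z \<in> space (Rn n \<Otimes>\<^sub>M Rn n)"
    then have "0 \<le> Q z"
      using p by (auto simp: Q_def predictive_density_def space_pair_measure)
    then show "(\<Sum>c\<in>codewords s m. Q z * exp (g c z)) \<le> Q z * real m ^ s"
      using avg[of z] by (simp add: mult_left_mono flip: sum_distrib_left)
  qed
  also have "\<dots> = real m ^ s"
    using Q by (simp add: has_bochner_integral_iff)
  finally have sumA: "(\<Sum>c\<in>codewords s m. A c) \<le> real (card (codewords s m))"
    by (simp add: card)
  obtain c where c: "c \<in> codewords s m" "A c \<le> 1"
  proof (rule ccontr)
    assume "\<not> thesis"
    then have "\<And>c. c \<in> codewords s m \<Longrightarrow> 1 < A c"
      using that by force
    then have "(\<Sum>c\<in>codewords s m. 1) < (\<Sum>c\<in>codewords s m. A c)"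
      using fin ne by (intro sum_strict_mono) auto
    then show False
      using sumA by simp
  qed
  have "real s * (L * (1 - \<epsilon>1 - real m * \<epsilon>2) - ln 2 - \<mu>\<^sup>2 / 2)
      \<le> 1 + E - (\<Sum>i<n. (spikes n s m \<mu> c i)\<^sup>2) / 2 - A c"
  proof -
    have "real (m - 1) * \<epsilon>2 \<le> real m * \<epsilon>2"
      by (intro mult_right_mono) (auto simp: \<epsilon>2_def)
    then have "real s * (L * (1 - \<epsilon>1 - real m * \<epsilon>2)) \<le> real s * (L * (1 - \<epsilon>1 - real (m - 1) * \<epsilon>2))"
      using L by (intro mult_left_mono) auto
    then show ?thesis
      using c(2) sum_spikes_square[OF m, of n s \<mu> c] by (simp add: E_def algebra_simps)
  qed
  also have "ereal (1 + E - (\<Sum>i<n. (spikes n s m \<mu> c i)\<^sup>2) / 2 - A c) \<le> risk n r (spikes n s m \<mu> c) p"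
    using risk_ge[OF r p g_int[OF c(1)] g_le] by (simp add: A_def Q_def split_beta')
  also have "\<dots> \<le> (SUP \<theta>\<in>sparse_vecs n s. risk n r \<theta> p)"
    using spikes_sparse[OF m] by (rule SUP_upper)
  finally show "ereal (real s * (L * (1 - exp (- (\<mu> - t)\<^sup>2 / (2 * v)) - real m * exp (- t\<^sup>2 / (2 * v)))
      - ln 2 - \<mu>\<^sup>2 / 2)) \<le> (SUP \<theta>\<in>sparse_vecs n s. risk n r \<theta> p)"
    by (simp add: \<epsilon>1_def \<epsilon>2_def)
qed

section \<open>Bayes predictive densities of finitely supported priors\<close>

definition marginal :: "real pmf \<Rightarrow> real \<Rightarrow> real" where
  "marginal P x = (\<Sum>t\<in>set_pmf P. pmf P t * gauss1 t 1 x)"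

definition joint_marginal :: "real pmf \<Rightarrow> real \<Rightarrow> real \<Rightarrow> real \<Rightarrow> real" where
  "joint_marginal P r x y = (\<Sum>t\<in>set_pmf P. pmf P t * (gauss1 t 1 x * gauss1 t r y))"

lemma marginal_pos:
  assumes "finite (set_pmf P)"
  shows "0 < marginal P x"
  unfolding marginal_def using assms set_pmf_not_empty[of P]
  by (intro sum_pos) (auto simp: gauss1_pos pmf_positive)

lemma joint_marginal_ge:
  assumes "finite (set_pmf P)" "t \<in> set_pmf P"
  shows "pmf P t * (gauss1 t 1 x * gauss1 t r y) \<le> joint_marginal P r x y"
  unfolding joint_marginal_def using assms
  by (intro member_le_sum) (auto intro!: mult_nonneg_nonneg)

lemma joint_marginal_pos:
  assumes "finite (set_pmf P)" "0 < r"
  shows "0 < joint_marginal P r x y"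
  unfolding joint_marginal_def using assms set_pmf_not_empty[of P]
  by (intro sum_pos) (auto simp: gauss1_pos pmf_positive)

lemma bayes_pred_eq:
  assumes fin: "finite (set_pmf P)"
  shows "bayes_pred r (measure_pmf P) x y = joint_marginal P r x y / marginal P x"
proof -
  have Z: "(\<integral>t. gauss1 t 1 x \<partial>measure_pmf P) = marginal P x"
    unfolding marginal_def using fin by (subst integral_measure_pmf[of "set_pmf P"]) auto
  have "bayes_pred r (measure_pmf P) x y
      = (\<integral>t. (gauss1 t 1 x / marginal P x) *\<^sub>R gauss1 t r y \<partial>measure_pmf P)"
    unfolding bayes_pred_def posterior_def Z
    using marginal_pos[OF fin, of x] by (intro integral_density) (auto intro: less_imp_le)
  also have "\<dots> = (\<Sum>t\<in>set_pmf P. pmf P t *\<^sub>R ((gauss1 t 1 x / marginal P x) *\<^sub>R gauss1 t r y))"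
    using fin by (intro integral_measure_pmf) auto
  also have "\<dots> = joint_marginal P r x y / marginal P x"
    by (simp add: joint_marginal_def sum_divide_distrib)
  finally show ?thesis .
qed

lemma nn_integral_gauss1: "0 < v \<Longrightarrow> (\<integral>\<^sup>+ y. ennreal (gauss1 \<theta> v y) \<partial>lborel) = 1"
  using prob_space.emeasure_space_1[OF prob_space_glaw[of v \<theta>]]
  by (simp add: glaw_def emeasure_density cong: nn_integral_cong)

lemma nn_integral_bayes_pred:
  assumes fin: "finite (set_pmf P)" and r: "0 < r"
  shows "(\<integral>\<^sup>+ y. ennreal (bayes_pred r (measure_pmf P) x y) \<partial>lborel) = 1"
proof -
  have c: "0 \<le> pmf P t * gauss1 t 1 x / marginal P x" for t
    using marginal_pos[OF fin, of x] by simp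
  have "(\<integral>\<^sup>+ y. ennreal (bayes_pred r (measure_pmf P) x y) \<partial>lborel)
      = (\<integral>\<^sup>+ y. (\<Sum>t\<in>set_pmf P. ennreal (pmf P t * gauss1 t 1 x / marginal P x) * ennreal (gauss1 t r y)) \<partial>lborel)"
  proof (intro nn_integral_cong)
    fix y
    have "(\<Sum>t\<in>set_pmf P. ennreal (pmf P t * gauss1 t 1 x / marginal P x) * ennreal (gauss1 t r y))
        = (\<Sum>t\<in>set_pmf P. ennreal (pmf P t * gauss1 t 1 x / marginal P x * gauss1 t r y))"
      using c by (intro sum.cong refl ennreal_mult[symmetric]) auto
    also have "\<dots> = ennreal (\<Sum>t\<in>set_pmf P. pmf P t * gauss1 t 1 x / marginal P x * gauss1 t r y)"
      by (intro sum_ennreal mult_nonneg_nonneg c) auto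
    also have "(\<Sum>t\<in>set_pmf P. pmf P t * gauss1 t 1 x / marginal P x * gauss1 t r y)
        = bayes_pred r (measure_pmf P) x y"
      by (simp add: bayes_pred_eq[OF fin] joint_marginal_def sum_divide_distrib mult_ac)
    finally show "ennreal (bayes_pred r (measure_pmf P) x y)
        = (\<Sum>t\<in>set_pmf P. ennreal (pmf P t * gauss1 t 1 x / marginal P x) * ennreal (gauss1 t r y))"
      by simp
  qed
  also have "\<dots> = (\<Sum>t\<in>set_pmf P. ennreal (pmf P t * gauss1 t 1 x / marginal P x))"
    using r by (simp add: nn_integral_sum nn_integral_cmult nn_integral_gauss1)
  also have "\<dots> = ennreal (\<Sum>t\<in>set_pmf P. pmf P t * gauss1 t 1 x / marginal P x)"
    using c by (intro sum_ennreal)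
  also have "(\<Sum>t\<in>set_pmf P. pmf P t * gauss1 t 1 x / marginal P x) = 1"
    using marginal_pos[OF fin, of x] by (simp add: marginal_def flip: sum_divide_distrib)
  finally show ?thesis
    by simp
qed

lemma bayes_pred_measurable:
  assumes "finite (set_pmf P)"
  shows "(\<lambda>z. bayes_pred r (measure_pmf P) (fst z) (snd z)) \<in> borel_measurable (borel \<Otimes>\<^sub>M borel)"
  unfolding bayes_pred_eq[OF assms] joint_marginal_def marginal_def by measurable

text \<open>Keeping a single atom \<open>\<mu>\<close> of the mixture over \<open>(x, y)\<close> loses its log mass, but makes the
  bound quadratic in \<open>y\<close>, so that its expectation is explicit.\<close>

lemma ln_bayes_pred_le:
  assumes fin: "finite (set_pmf P)" and r: "0 < r" and q: "0 < q" "q \<le> pmf P \<mu>"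
  shows "ln (gauss1 \<theta> r y / bayes_pred r (measure_pmf P) x y)
    \<le> ln (marginal P x / (q * gauss1 \<mu> 1 x)) + ((y - \<mu>)\<^sup>2 - (y - \<theta>)\<^sup>2) / (2 * r)"
proof -
  note pos = marginal_pos[OF fin, of x] joint_marginal_pos[OF fin r, of x y] gauss1_pos[OF r]
    gauss1_pos[OF zero_less_one, of \<mu> x]
  have "\<mu> \<in> set_pmf P"
    using q by (simp add: set_pmf_iff)
  then have "pmf P \<mu> * (gauss1 \<mu> 1 x * gauss1 \<mu> r y) \<le> joint_marginal P r x y"
    by (intro joint_marginal_ge fin)
  moreover have "q * (gauss1 \<mu> 1 x * gauss1 \<mu> r y) \<le> pmf P \<mu> * (gauss1 \<mu> 1 x * gauss1 \<mu> r y)"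
    using q by (intro mult_right_mono) auto
  ultimately have le: "q * (gauss1 \<mu> 1 x * gauss1 \<mu> r y) \<le> joint_marginal P r x y"
    by linarith
  have "gauss1 \<theta> r y / bayes_pred r (measure_pmf P) x y
      = marginal P x * gauss1 \<theta> r y / joint_marginal P r x y"
    by (simp add: bayes_pred_eq[OF fin])
  also have "\<dots> \<le> marginal P x * gauss1 \<theta> r y / (q * (gauss1 \<mu> 1 x * gauss1 \<mu> r y))"
    using le pos q by (intro divide_left_mono mult_pos_pos) auto
  also have "\<dots> = marginal P x / (q * gauss1 \<mu> 1 x) * (gauss1 \<theta> r y / gauss1 \<mu> r y)"
    by simp
  finally have "ln (gauss1 \<theta> r y / bayes_pred r (measure_pmf P) x y)
      \<le> ln (marginal P x / (q * gauss1 \<mu> 1 x) * (gauss1 \<theta> r y / gauss1 \<mu> r y))"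
    using pos by (simp add: bayes_pred_eq[OF fin] ln_mono)
  also have "\<dots> = ln (marginal P x / (q * gauss1 \<mu> 1 x)) + ln (gauss1 \<theta> r y / gauss1 \<mu> r y)"
    using pos(1,4) pos(3)[of \<theta> y] pos(3)[of \<mu> y] q by (intro ln_mult_pos) auto
  finally show ?thesis
    by (simp add: ln_gauss1_ratio[OF r])
qed

lemma ln_uniform_pred:
  assumes r: "0 < r"
  shows "ln (gauss1 \<theta> r y / gauss1 x (1 + r) y)
    = ln ((1 + r) / r) / 2 + (y - x)\<^sup>2 / (2 * (1 + r)) - (y - \<theta>)\<^sup>2 / (2 * r)"
proof -
  have "0 < 1 + r"
    using r by simp
  moreover from this have "ln ((1 + r) / r) = ln (1 + r) - ln r"
    using r by (intro ln_divide_pos) auto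
  ultimately show ?thesis
    using r gauss1_pos[OF r, of \<theta> y] gauss1_pos[of "1 + r" x y]
    by (simp add: ln_div[of "gauss1 \<theta> r y"] ln_gauss1 ln_mult_pos diff_divide_distrib
        add_divide_distrib del: minus_add_distrib)
qed

section \<open>The threshold estimator\<close>

lemma predictive_density_product:
  assumes pos: "\<And>x y. 0 < q x y"
    and meas: "(\<lambda>z. q (fst z) (snd z)) \<in> borel_measurable (borel \<Otimes>\<^sub>M borel)"
    and one: "\<And>x. (\<integral>\<^sup>+ y. ennreal (q x y) \<partial>lborel) = 1"
  shows "predictive_density n (\<lambda>x y. \<Prod>i<n. q (x i) (y i))"
  unfolding predictive_density_def
proof (intro conjI ballI)
  interpret product_sigma_finite "\<lambda>_::nat. lborel :: real measure"
    by standard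
  have [measurable]: "(\<lambda>z. q (fst z i) (snd z i)) \<in> borel_measurable (Rn n \<Otimes>\<^sub>M Rn n)" if "i < n" for i
  proof -
    have "(\<lambda>z. (fst z i, snd z i)) \<in> Rn n \<Otimes>\<^sub>M Rn n \<rightarrow>\<^sub>M borel \<Otimes>\<^sub>M (borel :: real measure)"
      using that unfolding Rn_def
      by (intro measurable_Pair measurable_compose[OF measurable_fst]
          measurable_compose[OF measurable_snd]) (auto intro: measurable_component_singleton[where M = "\<lambda>_. lborel", simplified])
    from measurable_compose[OF this meas] show ?thesis
      by simp
  qed
  show "(\<lambda>(x, y). \<Prod>i<n. q (x i) (y i)) \<in> borel_measurable (Rn n \<Otimes>\<^sub>M Rn n)"
    unfolding split_beta' by (intro borel_measurable_prod) auto
  show "0 \<le> (\<Prod>i<n. q (x i) (y i))" for x y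
    using pos by (intro prod_nonneg) (auto intro: less_imp_le)
  fix x :: "nat \<Rightarrow> real"
  have [measurable]: "(\<lambda>y. q a y) \<in> borel_measurable borel" for a
    using measurable_compose[OF measurable_Pair1'[of a borel borel] meas] by simp
  have "(\<integral>\<^sup>+ y. ennreal (\<Prod>i<n. q (x i) (y i)) \<partial>Rn n)
      = (\<integral>\<^sup>+ y. (\<Prod>i<n. ennreal (q (x i) (y i))) \<partial>Rn n)"
    using pos by (simp add: prod_ennreal less_imp_le)
  also have "\<dots> = (\<Prod>i<n. \<integral>\<^sup>+ t. ennreal (q (x i) t) \<partial>lborel)"
    unfolding Rn_def by (intro product_nn_integral_prod) auto
  finally show "(\<integral>\<^sup>+ y. ennreal (\<Prod>i<n. q (x i) (y i)) \<partial>Rn n) = 1"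
    using one by simp
qed

lemma threshold1_pos:
  assumes "finite (set_pmf (cluster_prior r \<eta>))" "0 < r"
  shows "0 < threshold1 r \<eta> x y"
  using assms marginal_pos[OF assms(1), of x] joint_marginal_pos[OF assms, of x y]
  by (simp add: threshold1_def bayes_pred_eq gauss1_pos)

lemma predictive_density_threshold:
  assumes fin: "finite (set_pmf (cluster_prior r \<eta>))" and r: "0 < r"
  shows "predictive_density n (threshold_est n r \<eta>)"
proof -
  have "predictive_density n (\<lambda>x y. \<Prod>i<n. threshold1 r \<eta> (x i) (y i))"
  proof (rule predictive_density_product)
    note bayes_pred_measurable[OF fin, measurable]
    have [measurable]: "(\<lambda>z. gauss1 (fst z) (1 + r) (snd z)) \<in> borel_measurable (borel \<Otimes>\<^sub>M borel)"
      using gauss1_measurable_pair[of "1 + r"] by (simp add: split_beta')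
    show "(\<lambda>z. threshold1 r \<eta> (fst z) (snd z)) \<in> borel_measurable (borel \<Otimes>\<^sub>M borel)"
      unfolding threshold1_def by measurable
    show "(\<integral>\<^sup>+ y. ennreal (threshold1 r \<eta> x y) \<partial>lborel) = 1" for x
      using r nn_integral_bayes_pred[OF fin r] nn_integral_gauss1[of "1 + r" x]
      by (cases "\<bar>x\<bar> \<le> lam_e \<eta>") (simp_all add: threshold1_def)
  qed (rule threshold1_pos[OF fin r])
  then show ?thesis
    by (simp add: threshold_est_def [abs_def])
qed

text \<open>The common part of all univariate bounds: \<open>\<mu>\<close> is the atom kept below the threshold, and above the
  threshold the loss of the uniform-prior predictive density is at most
  \<open>ln ((1 + r) / r) / 2 + (x - \<theta>)\<^sup>2 / 2\<close>.\<close>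

lemma risk1_threshold:
  assumes fin: "finite (set_pmf (cluster_prior r \<eta>))" and r: "0 < r"
    and q: "0 < q" "q \<le> pmf (cluster_prior r \<eta>) \<mu>"
    and below: "\<And>x. \<bar>x\<bar> \<le> lam_e \<eta> \<Longrightarrow>
      (\<theta> - \<mu>)\<^sup>2 / (2 * r) + ln (marginal (cluster_prior r \<eta>) x / (q * gauss1 \<mu> 1 x)) \<le> B x"
    and above: "\<And>x. lam_e \<eta> < \<bar>x\<bar> \<Longrightarrow> ln ((1 + r) / r) / 2 + (x - \<theta>)\<^sup>2 / 2 \<le> B x"
    and B: "has_bochner_integral (glaw \<theta> 1) B R'" "R' \<le> R"
  shows "risk1_le r (threshold1 r \<eta>) \<theta> R"
proof -
  let ?P = "cluster_prior r \<eta>"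
  define c where "c = (\<lambda>x. ln (marginal ?P x / (q * gauss1 \<mu> 1 x)))"
  define C where "C = ln ((1 + r) / r) / 2"
  define h where "h = (\<lambda>x y. if \<bar>x\<bar> \<le> lam_e \<eta> then c x + ((y - \<mu>)\<^sup>2 - (y - \<theta>)\<^sup>2) / (2 * r)
    else C + (y - x)\<^sup>2 / (2 * (1 + r)) - (y - \<theta>)\<^sup>2 / (2 * r))"
  define b where "b = (\<lambda>x. if \<bar>x\<bar> \<le> lam_e \<eta> then c x + ((r + (\<theta> - \<mu>)\<^sup>2) - r) / (2 * r)
    else C + (r + (\<theta> - x)\<^sup>2) / (2 * (1 + r)) - r / (2 * r))"
  have "ln (gauss1 \<theta> r y / threshold1 r \<eta> x y) \<le> h x y" for x y
    using ln_bayes_pred_le[OF fin r q, of \<theta> y x] ln_uniform_pred[OF r, of \<theta> y x]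
    by (simp add: threshold1_def h_def c_def C_def)
  moreover have "has_bochner_integral (glaw \<theta> r) (h x) (b x)" for x
  proof (cases "\<bar>x\<bar> \<le> lam_e \<eta>")
    case True
    have "has_bochner_integral (glaw \<theta> r) (\<lambda>y. c x + ((y - \<mu>)\<^sup>2 - (y - \<theta>)\<^sup>2) / (2 * r))
        (c x + ((r + (\<theta> - \<mu>)\<^sup>2) - r) / (2 * r))"
      using r by (intro has_bochner_integral_add has_bochner_integral_diff glaw_const glaw_square
          glaw_variance has_bochner_integral_divide_zero)
    then show ?thesis
      using True by (simp add: h_def b_def)
  next
    case False
    have "has_bochner_integral (glaw \<theta> r)
        (\<lambda>y. C + (y - x)\<^sup>2 / (2 * (1 + r)) - (y - \<theta>)\<^sup>2 / (2 * r))
        (C + (r + (\<theta> - x)\<^sup>2) / (2 * (1 + r)) - r / (2 * r))"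
      using r by (intro has_bochner_integral_add has_bochner_integral_diff glaw_const glaw_square
          glaw_variance has_bochner_integral_divide_zero)
    then show ?thesis
      using False by (simp add: h_def b_def)
  qed
  moreover have "b x \<le> B x" for x
  proof (cases "\<bar>x\<bar> \<le> lam_e \<eta>")
    case True
    then show ?thesis
      using below[OF True] by (simp add: b_def c_def add.commute)
  next
    case False
    have "(r + (\<theta> - x)\<^sup>2) / (2 * (1 + r)) \<le> (1 + (\<theta> - x)\<^sup>2) / 2"
      using r by (simp add: field_simps)
    moreover have "r / (2 * r) = 1 / 2"
      using r by simp
    moreover have "b x = C + (r + (\<theta> - x)\<^sup>2) / (2 * (1 + r)) - r / (2 * r)"
      using False by (simp only: b_def if_False)
    moreover have "C + (\<theta> - x)\<^sup>2 / 2 \<le> B x"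
      using False above[of x] by (simp add: C_def power2_commute)
    ultimately show ?thesis
      by (simp add: add_divide_distrib)
  qed
  ultimately show ?thesis
    unfolding risk1_le_def using B by blast
qed

section \<open>The cluster prior\<close>

text \<open>The constants and rates of the bounds, as functions of \<open>l = lam_e \<eta>\<close>. In \<open>signal_risk_bound\<close> only the
  first summand is of order \<open>l\<^sup>2\<close>; the expression \<open>sqrt (2 * ln (sqrt (v_w r) * l))\<close> is the
  offset. The function \<open>lower_rate\<close> is the lower bound per block for the decision level
  \<open>t = sqrt v * (l + sqrt l)\<close> and the spike height \<open>sqrt v * (l + 2 * sqrt l)\<close>: a margin that is
  unbounded, so that decoding succeeds, but of smaller order than \<open>l\<close>.\<close>

definition cluster_size_bound :: "real \<Rightarrow> real" where
  "cluster_size_bound r = 1 + 3 / (r * sqrt (v_w r))"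

definition uniform_loss :: "real \<Rightarrow> real" where
  "uniform_loss r = ln ((1 + r) / r) / 2"

definition signal_risk_bound :: "real \<Rightarrow> real \<Rightarrow> real" where
  "signal_risk_bound r l = l\<^sup>2 / (2 * (1 + r)) + v_w r * sqrt (2 * ln (sqrt (v_w r) * l)) * l +
     ln (8 * cluster_size_bound r) + (l + sqrt (2 * ln (sqrt (v_w r) * l))) + uniform_loss r + 1 / 2 +
     ln 4 + (l / sqrt (v_w r) + 2) / r"

definition lower_rate :: "real \<Rightarrow> real \<Rightarrow> real" where
  "lower_rate r l = l\<^sup>2 / 2 * (1 - exp (- l / 2) - 2 * exp (l\<^sup>2 / 2 - (l + sqrt l)\<^sup>2 / 2)) -
     ln 2 - v_w r * (l + 2 * sqrt l)\<^sup>2 / 2"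

text \<open>The range of \<open>\<eta>\<close> in which the square roots and the cluster prior are meaningful; it is reached
  eventually when \<open>\<eta>\<close> tends to \<open>0\<close>.\<close>

locale small_sparsity =
  fixes r \<eta> :: real
  assumes r: "0 < r" and \<eta>: "0 < \<eta>" "\<eta> \<le> 1 / 2"
    and lam2: "2 \<le> lam_e \<eta>" and lam_f1: "1 \<le> lam_f r \<eta>"
begin

abbreviation "lam \<equiv> lam_e \<eta>"
abbreviation "a \<equiv> offset r \<eta>"
abbreviation "v \<equiv> v_w r"
abbreviation "K \<equiv> num_pts r \<eta>"
abbreviation "P \<equiv> cluster_prior r \<eta>"
abbreviation "K_bound \<equiv> cluster_size_bound r"
abbreviation "C0 \<equiv> uniform_loss r"
abbreviation "risk_bound \<equiv> signal_risk_bound r lam"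

lemma v01: "0 < v" "v < 1"
  using r by (simp_all add: v_w_eq)

lemma odds_pos: "0 < (1 - \<eta>) / \<eta>"
  using \<eta> by simp

lemma lam_square: "lam\<^sup>2 = 2 * ln ((1 - \<eta>) / \<eta>)"
proof -
  have "1 \<le> (1 - \<eta>) / \<eta>"
    using \<eta> by simp
  then show ?thesis
    by (simp add: lam_e_def divide_inverse mult.commute)
qed

lemma exp_lam: "exp (lam\<^sup>2 / 2) = (1 - \<eta>) / \<eta>" "exp (- lam\<^sup>2 / 2) = \<eta> / (1 - \<eta>)"
  using odds_pos by (simp_all add: lam_square exp_minus)

lemma lam_f_eq: "lam_f r \<eta> = sqrt v * lam"
  by (simp add: lam_f_def)

lemma a_nonneg: "0 \<le> a"
  using lam_f1 by (simp add: offset_def)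

lemma a_square: "a\<^sup>2 = 2 * ln (lam_f r \<eta>)"
  using lam_f1 by (simp add: offset_def)

lemma exp_a: "exp (- a\<^sup>2 / 2) = 1 / lam_f r \<eta>"
  using lam_f1 by (simp add: a_square exp_minus inverse_eq_divide)

lemma a_le_lam: "a \<le> lam"
proof (rule power2_le_imp_le)
  have "ln (lam_f r \<eta>) \<le> lam_f r \<eta>"
    using lam_f1 by (intro order_trans[OF ln_le_minus_one]) auto
  also have "\<dots> \<le> 1 * lam"
    using v01 lam2 unfolding lam_f_eq by (intro mult_right_mono) auto
  finally have "a\<^sup>2 \<le> 2 * lam"
    by (simp add: a_square)
  also have "\<dots> \<le> lam * lam"
    using lam2 by (intro mult_right_mono) auto
  finally show "a\<^sup>2 \<le> lam\<^sup>2"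
    by (simp add: power2_eq_square)
  show "0 \<le> lam"
    using lam2 by simp
qed

lemma mu_root_props:
  "0 < mu_root r \<eta>" "(mu_root r \<eta>)\<^sup>2 + 2 * a * mu_root r \<eta> = lam\<^sup>2"
proof -
  let ?Q = "\<lambda>\<mu>. 0 < \<mu> \<and> \<mu>\<^sup>2 + 2 * a * \<mu> = lam\<^sup>2"
  have "?Q (sqrt (a\<^sup>2 + lam\<^sup>2) - a)"
  proof
    have "0 < lam\<^sup>2"
      using lam2 by simp
    then show "0 < sqrt (a\<^sup>2 + lam\<^sup>2) - a"
      using a_nonneg by (simp add: real_less_rsqrt)
    have "(sqrt (a\<^sup>2 + lam\<^sup>2))\<^sup>2 = a\<^sup>2 + lam\<^sup>2"
      by simp
    then show "(sqrt (a\<^sup>2 + lam\<^sup>2) - a)\<^sup>2 + 2 * a * (sqrt (a\<^sup>2 + lam\<^sup>2) - a) = lam\<^sup>2"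
      by (simp add: power2_eq_square algebra_simps)
  qed
  moreover have "x = y" if "?Q x" "?Q y" for x y
  proof -
    have "(x - y) * (x + y + 2 * a) = 0"
      using that by (simp add: power2_eq_square algebra_simps)
    moreover have "0 < x + y + 2 * a"
      using that a_nonneg by simp
    ultimately show ?thesis
      by simp
  qed
  ultimately have "?Q (mu_root r \<eta>)"
    unfolding mu_root_def by (intro theI[of ?Q]) blast+
  then show "0 < mu_root r \<eta>" "(mu_root r \<eta>)\<^sup>2 + 2 * a * mu_root r \<eta> = lam\<^sup>2"
    by simp_all
qed

lemma mu_root_le: "mu_root r \<eta> \<le> lam"
proof (rule power2_le_imp_le)
  show "(mu_root r \<eta>)\<^sup>2 \<le> lam\<^sup>2"
    using mu_root_props a_nonneg mult_nonneg_nonneg[of a "mu_root r \<eta>"] by linarith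
qed (use lam2 in simp)

lemma mu_root_ge: "lam / 3 \<le> mu_root r \<eta>"
proof (rule ccontr)
  assume "\<not> ?thesis"
  then have m: "mu_root r \<eta> < lam / 3"
    by simp
  have "(mu_root r \<eta>)\<^sup>2 \<le> (lam / 3)\<^sup>2"
    using m mu_root_props(1) by (intro power_mono) auto
  moreover have "a * mu_root r \<eta> \<le> lam * (lam / 3)"
    using m mu_root_props(1) a_le_lam a_nonneg by (intro mult_mono) auto
  moreover have "0 < lam\<^sup>2"
    using lam2 by simp
  ultimately show False
    using mu_root_props(2) by (simp add: power2_eq_square field_simps)
qed

lemma nu_pos: "0 < nu r \<eta>"
  using v01 mu_root_props by (simp add: nu_def)

lemma nu_le: "nu r \<eta> \<le> lam_f r \<eta>"
  using v01 mu_root_le by (simp add: nu_def lam_f_eq mult_left_mono)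

lemma lam_f_le: "lam_f r \<eta> \<le> lam"
  using v01 lam2 mult_right_mono[of "sqrt v" 1 lam] by (simp add: lam_f_eq)

text \<open>The bottom of the cluster is lower than \<open>lam_f\<close> only by a negligible amount.\<close>

lemma nu_square_ge: "(lam_f r \<eta>)\<^sup>2 - 2 * v * a * lam \<le> (nu r \<eta>)\<^sup>2"
proof -
  have "(nu r \<eta>)\<^sup>2 = v * (mu_root r \<eta>)\<^sup>2"
    using v01 by (simp add: nu_def power_mult_distrib)
  also have "(mu_root r \<eta>)\<^sup>2 = lam\<^sup>2 - 2 * a * mu_root r \<eta>"
    using mu_root_props by simp
  finally have "(nu r \<eta>)\<^sup>2 = v * lam\<^sup>2 - 2 * v * a * mu_root r \<eta>"
    by (simp add: algebra_simps)
  moreover have "2 * v * a * mu_root r \<eta> \<le> 2 * v * a * lam"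
    using v01 a_nonneg mu_root_le by (intro mult_left_mono) auto
  ultimately show ?thesis
    using v01 by (simp add: lam_f_eq power_mult_distrib)
qed

lemma support_pt_pos: "0 < support_pt r \<eta> k"
  using r nu_pos by (simp add: support_pt_def)

lemma support_pt_Suc: "1 \<le> k \<Longrightarrow> support_pt r \<eta> (Suc k) = (1 + 2 * r) * support_pt r \<eta> k"
  by (cases k) (simp_all add: support_pt_def)

lemma support_pt_ge: "nu r \<eta> \<le> support_pt r \<eta> k"
  using r nu_pos by (simp add: support_pt_def one_le_power)

text \<open>The support points grow geometrically from a constant multiple of \<open>lam\<close> up to at most \<open>2 * lam\<close>, so
  their number stays bounded and the factor \<open>1 / (2 K)\<close> in the weights is harmless.\<close>

lemma index_bound:
  assumes "1 \<le> k" "support_pt r \<eta> k \<le> lam + a"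
  shows "real k \<le> K_bound"
proof -
  have "1 + real (k - 1) * (2 * r) \<le> (1 + 2 * r) ^ (k - 1)"
    using r by (intro Bernoulli_inequality) auto
  then have "real (k - 1) * (2 * r) * nu r \<eta> \<le> (1 + 2 * r) ^ (k - 1) * nu r \<eta>"
    using nu_pos by (intro mult_right_mono) auto
  also have "\<dots> \<le> 2 * lam"
    using assms a_le_lam by (simp add: support_pt_def)
  finally have "real (k - 1) * (2 * r) * nu r \<eta> \<le> 2 * lam" .
  moreover have "real (k - 1) * (2 * r) * (sqrt v * (lam / 3)) \<le> real (k - 1) * (2 * r) * nu r \<eta>"
    using r v01 mu_root_ge unfolding nu_def by (intro mult_left_mono) auto
  ultimately have "real (k - 1) * (r * sqrt v) * lam \<le> 3 * lam"
    by (simp add: field_simps)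
  then have "real (k - 1) * (r * sqrt v) \<le> 3"
    using lam2 by simp
  then have "real (k - 1) \<le> 3 / (r * sqrt v)"
    using r v01 by (simp add: pos_le_divide_eq)
  then show ?thesis
    using assms by (simp add: cluster_size_bound_def of_nat_diff)
qed

lemma num_pts_props:
  "1 \<le> K" "support_pt r \<eta> K \<le> lam + a" "lam + a < support_pt r \<eta> (Suc K)" "real K \<le> K_bound"
proof -
  let ?S = "{k. 1 \<le> k \<and> support_pt r \<eta> k \<le> lam + a}"
  have "?S \<subseteq> {..nat \<lceil>K_bound\<rceil>}"
  proof
    fix k assume "k \<in> ?S"
    then have "real k \<le> K_bound"
      using index_bound by blast
    also have "\<dots> \<le> real (nat \<lceil>K_bound\<rceil>)"
      by (rule real_nat_ceiling_ge)
    finally show "k \<in> {..nat \<lceil>K_bound\<rceil>}"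
      by simp
  qed
  then have fin: "finite ?S"
    using finite_subset by blast
  have "1 \<in> ?S"
    using nu_le lam_f_le a_nonneg by (simp add: support_pt_def)
  then have "K \<in> ?S"
    unfolding num_pts_def using fin by (intro Max_in) auto
  then show K: "1 \<le> K" "support_pt r \<eta> K \<le> lam + a"
    by auto
  show "real K \<le> K_bound"
    using index_bound K by blast
  show "lam + a < support_pt r \<eta> (Suc K)"
  proof (rule ccontr)
    assume "\<not> ?thesis"
    then have "Suc K \<le> Max ?S"
      using fin by (intro Max_ge) auto
    then show False
      by (simp add: num_pts_def)
  qed
qed

lemma exists_support_pt:
  assumes "nu r \<eta> \<le> x" "x \<le> lam + a"
  obtains k where "1 \<le> k" "k \<le> K" "support_pt r \<eta> k \<le> x" "x \<le> (1 + 2 * r) * support_pt r \<eta> k"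
proof -
  let ?S = "{k. 1 \<le> k \<and> k \<le> K \<and> support_pt r \<eta> k \<le> x}"
  have fin: "finite ?S"
    by (rule finite_subset[of _ "{..K}"]) auto
  have "1 \<in> ?S"
    using num_pts_props assms by (simp add: support_pt_def)
  then have k: "Max ?S \<in> ?S"
    using fin by (intro Max_in) auto
  have "x \<le> support_pt r \<eta> (Suc (Max ?S))"
  proof (rule ccontr)
    assume n: "\<not> ?thesis"
    show False
    proof (cases "Max ?S = K")
      case True
      then show False
        using n num_pts_props assms by simp
    next
      case False
      then have "Suc (Max ?S) \<le> Max ?S"
        using n k fin by (intro Max_ge) auto
      then show False
        by simp
    qed
  qed
  then show ?thesis
    using k support_pt_Suc that by auto
qed

lemma pmf_P: "pmf P t = cluster_mass r \<eta> t"
  using \<eta> num_pts_props by (intro pmf_cluster_prior) auto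

lemma finite_P: "finite (set_pmf P)"
proof (rule finite_subset)
  show "set_pmf P \<subseteq> insert 0 (support_pt r \<eta> ` {1..K} \<union> (\<lambda>k. - support_pt r \<eta> k) ` {1..K})"
  proof
    fix t assume t: "t \<in> set_pmf P"
    show "t \<in> insert 0 (support_pt r \<eta> ` {1..K} \<union> (\<lambda>k. - support_pt r \<eta> k) ` {1..K})"
    proof (rule ccontr)
      assume n: "\<not> ?thesis"
      then have "t \<noteq> 0" "\<forall>k\<in>{1..K}. t \<noteq> support_pt r \<eta> k \<and> t \<noteq> - support_pt r \<eta> k"
        by auto
      then have "cluster_mass r \<eta> t = 0"
        by (simp add: cluster_mass_def indicator_def)
      then show False
        using t by (simp add: set_pmf_iff pmf_P)
    qed
  qed
qed simp

lemma pmf_zero: "1 - \<eta> \<le> pmf P 0"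
  using \<eta> unfolding pmf_P cluster_mass_def
  by (simp add: sum_nonneg)

lemma pmf_support_pt:
  assumes "1 \<le> k" "k \<le> K" "\<bar>\<sigma>\<bar> = 1"
  shows "\<eta> / (2 * real K) \<le> pmf P (\<sigma> * support_pt r \<eta> k)"
proof -
  let ?t = "\<sigma> * support_pt r \<eta> k"
  have "1 \<le> indicator {support_pt r \<eta> k} ?t + (indicator {- support_pt r \<eta> k} ?t :: real)"
    using assms by (auto simp: indicator_def abs_if split: if_splits)
  also have "\<dots> \<le> (\<Sum>k = 1..K. indicator {support_pt r \<eta> k} ?t + indicator {- support_pt r \<eta> k} ?t)"
    using assms by (intro member_le_sum) auto
  finally have "\<eta> / (2 * real K) * 1 \<le> \<eta> / (2 * real K) *
      (\<Sum>k = 1..K. indicator {support_pt r \<eta> k} ?t + indicator {- support_pt r \<eta> k} ?t)"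
    using \<eta> by (intro mult_left_mono) auto
  moreover have "0 \<le> (1 - \<eta>) * indicator {0} ?t"
    using \<eta> by (simp add: indicator_def)
  ultimately show ?thesis
    unfolding pmf_P cluster_mass_def by linarith
qed

text \<open>This bound is why \<open>lam_e\<close> is the right threshold: the prior odds \<open>\<eta> / (1 - \<eta>)\<close> of a signal
  exactly offset the largest possible likelihood ratio on \<open>\<bar>x\<bar> \<le> lam_e\<close>.\<close>

lemma marginal_le:
  assumes x: "\<bar>x\<bar> \<le> lam"
  shows "marginal P x \<le> 2 * gauss1 0 1 x"
proof -
  have LR: "exp (t * x - t\<^sup>2 / 2) \<le> (1 - \<eta>) / \<eta>" for t
  proof -
    have "t * x - t\<^sup>2 / 2 \<le> x\<^sup>2 / 2"
      using sum_squares_bound[of t x] by (simp add: power2_eq_square)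
    also have "\<dots> \<le> lam\<^sup>2 / 2"
      using x power_mono[of "\<bar>x\<bar>" lam 2] by simp
    finally show ?thesis
      unfolding exp_lam(1)[symmetric] by simp
  qed
  have zero: "0 \<in> set_pmf P"
    using pmf_zero \<eta> by (simp add: set_pmf_iff)
  have "(\<Sum>t\<in>set_pmf P - {0}. pmf P t) = 1 - pmf P 0"
    using sum_pmf_eq_1[OF finite_P subset_refl] sum.remove[OF finite_P zero, of "pmf P"] by simp
  then have rest: "(\<Sum>t\<in>set_pmf P - {0}. pmf P t) \<le> \<eta>"
    using pmf_zero by simp
  have "marginal P x = pmf P 0 * gauss1 0 1 x + (\<Sum>t\<in>set_pmf P - {0}. pmf P t * gauss1 t 1 x)"
    unfolding marginal_def by (rule sum.remove[OF finite_P zero])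
  also have "\<dots> \<le> 1 * gauss1 0 1 x
      + (\<Sum>t\<in>set_pmf P - {0}. pmf P t * (gauss1 0 1 x * ((1 - \<eta>) / \<eta>)))"
  proof (intro add_mono mult_right_mono sum_mono mult_left_mono)
    show "gauss1 t 1 x \<le> gauss1 0 1 x * ((1 - \<eta>) / \<eta>)" for t
      unfolding gauss1_ratio[of t] using LR by (intro mult_left_mono) auto
  qed (auto simp: pmf_le_1)
  also have "\<dots> = gauss1 0 1 x + (\<Sum>t\<in>set_pmf P - {0}. pmf P t) * (gauss1 0 1 x * ((1 - \<eta>) / \<eta>))"
    by (simp only: sum_distrib_right mult_1)
  also have "\<dots> \<le> gauss1 0 1 x + \<eta> * (gauss1 0 1 x * ((1 - \<eta>) / \<eta>))"
    using rest odds_pos by (intro add_left_mono mult_right_mono mult_nonneg_nonneg) auto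
  also have "\<eta> * (gauss1 0 1 x * ((1 - \<eta>) / \<eta>)) = (1 - \<eta>) * gauss1 0 1 x"
    using \<eta> by simp
  also have "gauss1 0 1 x + (1 - \<eta>) * gauss1 0 1 x \<le> 2 * gauss1 0 1 x"
    using \<eta> mult_nonneg_nonneg[of \<eta> "gauss1 0 1 x"] by (simp add: left_diff_distrib)
  finally show ?thesis .
qed

section \<open>Univariate risk of the threshold estimator\<close>

lemma C0_nonneg: "0 \<le> C0"
  using r by (simp add: uniform_loss_def)

text \<open>A plain Chernoff bound would lose the factor \<open>1 / lam\<close> that makes the zero coordinates negligible. The
  weight \<open>x\<^sup>2 - 1\<close> has total integral \<open>0\<close> and the antiderivative \<open>- x * gauss1 0 1 x\<close>, which gives the
  tail in closed form; for \<open>\<bar>x\<bar> > lam\<close> it dominates the quadratic loss.\<close>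

lemma gauss_tail:
  "has_bochner_integral (glaw 0 1) (\<lambda>x. (x\<^sup>2 - 1) * indicator {x. lam < \<bar>x\<bar>} x) (2 * lam * gauss1 0 1 lam)"
proof -
  let ?F = "\<lambda>x. - x * gauss1 0 1 x"
  define c where "c = 1 / sqrt (2 * pi)"
  have g0: "gauss1 0 1 = (\<lambda>x. c * exp (- x\<^sup>2 / 2))"
    by (simp add: gauss1_eq fun_eq_iff c_def)
  have "has_bochner_integral lborel (\<lambda>x. (gauss1 0 1 x * (x\<^sup>2 - 1)) * indicator {- lam..lam} x)
      (?F lam - ?F (- lam))"
  proof (rule has_bochner_integral_FTC_Icc_real)
    show "- lam \<le> lam"
      using lam2 by simp
    show "DERIV ?F x :> gauss1 0 1 x * (x\<^sup>2 - 1)" for x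
      unfolding g0
      by (auto intro!: derivative_eq_intros simp: power2_eq_square field_simps)
    show "isCont (\<lambda>x. gauss1 0 1 x * (x\<^sup>2 - 1)) x" for x
      unfolding g0 by (intro continuous_intros) auto
  qed
  moreover have "gauss1 0 1 (- lam) = gauss1 0 1 lam"
    by (simp add: g0)
  ultimately have "has_bochner_integral lborel
      (\<lambda>x. gauss1 0 1 x * ((x\<^sup>2 - 1) * indicator {- lam..lam} x)) (- (2 * lam * gauss1 0 1 lam))"
    by (simp add: mult_ac)
  then have inner: "has_bochner_integral (glaw 0 1) (\<lambda>x. (x\<^sup>2 - 1) * indicator {- lam..lam} x)
      (- (2 * lam * gauss1 0 1 lam))"
    by (intro has_bochner_integral_glaw) auto
  have whole: "has_bochner_integral (glaw 0 1) (\<lambda>x. x\<^sup>2 - 1) (1 - 1)"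
    using glaw_variance[of 1 0] by (intro has_bochner_integral_diff glaw_const) auto
  have "(\<lambda>x. (x\<^sup>2 - 1) * indicator {x. lam < \<bar>x\<bar>} x)
      = (\<lambda>x. (x\<^sup>2 - 1) - (x\<^sup>2 - 1) * indicator {- lam..lam} x)"
    by (auto simp: fun_eq_iff indicator_def abs_if)
  then show ?thesis
    using has_bochner_integral_diff[OF whole inner] by simp
qed

lemma gauss_at_lam: "2 * lam * gauss1 0 1 lam \<le> lam * (\<eta> / (1 - \<eta>))"
proof -
  have "sqrt (2 * pi) \<ge> 2"
    using pi_gt3 by (intro real_le_rsqrt) simp
  then have "2 / sqrt (2 * pi) \<le> 1"
    by simp
  then have "2 / sqrt (2 * pi) * (lam * (\<eta> / (1 - \<eta>))) \<le> 1 * (lam * (\<eta> / (1 - \<eta>)))"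
    using lam2 \<eta> by (intro mult_right_mono) auto
  moreover have "2 * lam * gauss1 0 1 lam = 2 / sqrt (2 * pi) * (lam * (\<eta> / (1 - \<eta>)))"
    by (simp add: gauss1_eq flip: exp_lam(2))
  ultimately show ?thesis
    by simp
qed

text \<open>Below the threshold \<open>ln z \<le> z - 1\<close> is applied to the ratio of the marginal density of \<open>x\<close> to its
  part from the atom \<open>0\<close>. The ratio of the marginal to \<open>gauss1 0 1\<close> has expectation \<open>1\<close> under \<open>\<theta> = 0\<close>, which
  leaves only \<open>1 / (1 - \<eta>) - 1\<close>; since \<open>z - 1 \<ge> 0\<close>, the restriction to \<open>\<bar>x\<bar> \<le> lam\<close> can be dropped.\<close>

lemma risk1_zero: "risk1_le r (threshold1 r \<eta>) 0 ((1 + (C0 + 1) * lam) * (\<eta> / (1 - \<eta>)))"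
proof (rule risk1_threshold[OF finite_P r, of "1 - \<eta>" 0])
  let ?M = "\<lambda>x. \<Sum>t\<in>set_pmf P. pmf P t * exp (- t\<^sup>2 / 2) * exp (t * x)"
  have M: "marginal P x / gauss1 0 1 x = ?M x" for x
  proof -
    have "marginal P x = (\<Sum>t\<in>set_pmf P. pmf P t * exp (- t\<^sup>2 / 2) * exp (t * x)) * gauss1 0 1 x"
      unfolding marginal_def sum_distrib_right
      by (intro sum.cong refl, subst gauss1_ratio) (simp flip: exp_add)
    then show ?thesis
      using gauss1_pos[of 1 0 x] by simp
  qed
  define B where "B = (\<lambda>x. ?M x / (1 - \<eta>) - 1 + (C0 + 1) * ((x\<^sup>2 - 1) * indicator {x. lam < \<bar>x\<bar>} x))"
  have Mpos: "0 < ?M x" for x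
    unfolding M[symmetric] using marginal_pos[OF finite_P, of x] gauss1_pos[of 1 0 x] by simp
  show "0 < 1 - \<eta>" "1 - \<eta> \<le> pmf P 0"
    using \<eta> pmf_zero by auto
  show "(0 - 0)\<^sup>2 / (2 * r) + ln (marginal P x / ((1 - \<eta>) * gauss1 0 1 x)) \<le> B x" if "\<bar>x\<bar> \<le> lam" for x
  proof -
    have "marginal P x / ((1 - \<eta>) * gauss1 0 1 x) = ?M x / (1 - \<eta>)"
      unfolding M[symmetric] by (simp add: mult.commute)
    then show ?thesis
      using ln_le_minus_one[of "?M x / (1 - \<eta>)"] Mpos[of x] \<eta> that by (simp add: B_def)
  qed
  show "ln ((1 + r) / r) / 2 + (x - 0)\<^sup>2 / 2 \<le> B x" if "lam < \<bar>x\<bar>" for x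
  proof -
    have "2 * 2 \<le> \<bar>x\<bar> * \<bar>x\<bar>"
      using that lam2 by (intro mult_mono) auto
    then have x: "4 \<le> x\<^sup>2"
      by (simp add: power2_eq_square)
    have "(1 - \<eta>) * gauss1 0 1 x \<le> pmf P 0 * gauss1 0 1 x"
      using pmf_zero by (intro mult_right_mono) auto
    also have "\<dots> \<le> marginal P x"
      unfolding marginal_def using pmf_zero \<eta> finite_P
      by (intro member_le_sum[of 0 _ "\<lambda>t. pmf P t * gauss1 t 1 x"]) (auto simp: set_pmf_iff)
    finally have "1 - \<eta> \<le> ?M x"
      unfolding M[symmetric] using gauss1_pos[of 1 0 x] by (simp add: pos_le_divide_eq)
    then have "1 \<le> ?M x / (1 - \<eta>)"
      using \<eta> by simp
    moreover have "C0 * 1 \<le> C0 * (x\<^sup>2 - 1)"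
      using C0_nonneg x by (intro mult_left_mono) auto
    ultimately show ?thesis
      using that x by (simp add: B_def uniform_loss_def[symmetric] algebra_simps)
  qed
  have "has_bochner_integral (glaw 0 1) ?M
      (\<Sum>t\<in>set_pmf P. pmf P t * exp (- t\<^sup>2 / 2) * exp (t * 0 + t\<^sup>2 * 1 / 2))"
    by (intro has_bochner_integral_sum has_bochner_integral_mult_right glaw_exp) auto
  also have "(\<Sum>t\<in>set_pmf P. pmf P t * exp (- t\<^sup>2 / 2) * exp (t * 0 + t\<^sup>2 * 1 / 2)) = 1"
    using sum_pmf_eq_1[OF finite_P subset_refl] by (simp add: mult.assoc flip: exp_add)
  finally have "has_bochner_integral (glaw 0 1) ?M 1" .
  then show "has_bochner_integral (glaw 0 1) B
      (1 / (1 - \<eta>) - 1 + (C0 + 1) * (2 * lam * gauss1 0 1 lam))"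
    unfolding B_def
    by (intro has_bochner_integral_add has_bochner_integral_diff has_bochner_integral_divide_zero
        glaw_const has_bochner_integral_mult_right gauss_tail) auto
  have "1 / (1 - \<eta>) - 1 = \<eta> / (1 - \<eta>)"
    using \<eta> by (simp add: field_simps)
  moreover have "(C0 + 1) * (2 * lam * gauss1 0 1 lam) \<le> (C0 + 1) * (lam * (\<eta> / (1 - \<eta>)))"
    using gauss_at_lam C0_nonneg by (intro mult_left_mono) auto
  ultimately show "1 / (1 - \<eta>) - 1 + (C0 + 1) * (2 * lam * gauss1 0 1 lam)
      \<le> (1 + (C0 + 1) * lam) * (\<eta> / (1 - \<eta>))"
    by (simp add: algebra_simps add_divide_distrib)
qed

lemma ln_marginal_ratio_le:
  assumes "\<bar>x\<bar> \<le> lam" "0 < q"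
  shows "ln (marginal P x / (q * gauss1 \<mu> 1 x)) \<le> ln (2 / q) + \<mu>\<^sup>2 / 2 - \<mu> * x"
proof -
  have "marginal P x / (q * gauss1 \<mu> 1 x) \<le> 2 * gauss1 0 1 x / (q * gauss1 \<mu> 1 x)"
    using marginal_le[OF assms(1)] assms(2) by (intro divide_right_mono) auto
  also have "\<dots> = 2 / q * exp (\<mu>\<^sup>2 / 2 - \<mu> * x)"
  proof -
    have "exp (\<mu>\<^sup>2 / 2 - \<mu> * x) = inverse (exp (\<mu> * x - \<mu>\<^sup>2 / 2))"
      by (simp flip: exp_minus)
    then show ?thesis
      using gauss1_pos[of 1 0 x] assms(2) unfolding gauss1_ratio[of \<mu>]
      by (simp add: inverse_eq_divide)
  qed
  finally have "ln (marginal P x / (q * gauss1 \<mu> 1 x)) \<le> ln (2 / q * exp (\<mu>\<^sup>2 / 2 - \<mu> * x))"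
    using marginal_pos[OF finite_P, of x] gauss1_pos[of 1 \<mu> x] assms(2) by (intro ln_mono) auto
  also have "\<dots> = ln (2 / q) + ln (exp (\<mu>\<^sup>2 / 2 - \<mu> * x))"
    using assms(2) by (intro ln_mult_pos) auto
  finally show ?thesis
    by simp
qed

lemma risk1_atom_zero:
  assumes B: "has_bochner_integral (glaw \<theta> 1) (\<lambda>x. B x + (C0 + (x - \<theta>)\<^sup>2 / 2)) R'" "R' \<le> R"
    and B0: "\<And>x. 0 \<le> B x"
    and le: "\<And>x. \<bar>x\<bar> \<le> lam \<Longrightarrow> \<theta>\<^sup>2 / (2 * r) + ln 4 \<le> B x"
  shows "risk1_le r (threshold1 r \<eta>) \<theta> R"
proof (rule risk1_threshold[OF finite_P r _ _ _ _ B])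
  show "0 < (1 / 2 :: real)" "1 / 2 \<le> pmf P 0"
    using \<eta> pmf_zero by auto
  show "(\<theta> - 0)\<^sup>2 / (2 * r) + ln (marginal P x / (1 / 2 * gauss1 0 1 x)) \<le> B x + (C0 + (x - \<theta>)\<^sup>2 / 2)"
    if "\<bar>x\<bar> \<le> lam" for x
  proof -
    have "ln (marginal P x / (1 / 2 * gauss1 0 1 x)) \<le> ln 4"
      using ln_marginal_ratio_le[OF that, of "1 / 2" 0] by simp
    moreover have "0 \<le> C0 + (x - \<theta>)\<^sup>2 / 2"
      using C0_nonneg by simp
    ultimately show ?thesis
      using le[OF that] unfolding diff_zero by linarith
  qed
  show "ln ((1 + r) / r) / 2 + (x - \<theta>)\<^sup>2 / 2 \<le> B x + (C0 + (x - \<theta>)\<^sup>2 / 2)" for x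
    using B0[of x] by (simp add: uniform_loss_def)
qed

lemma risk_bound_eq:
  "risk_bound = lam\<^sup>2 / (2 * (1 + r)) + v * a * lam + ln (8 * K_bound) + (lam + a) + C0 + 1 / 2 +
     ln 4 + (lam / sqrt v + 2) / r"
  by (simp add: signal_risk_bound_def offset_def lam_f_def)

lemma K_bound_ge: "1 \<le> K_bound"
  using r v01 by (simp add: cluster_size_bound_def)

lemma glaw_square_half:
  "has_bochner_integral (glaw \<theta> 1) (\<lambda>x. C0 + (x - \<theta>)\<^sup>2 / 2) (C0 + 1 / 2)"
  by (intro has_bochner_integral_add glaw_const has_bochner_integral_divide_zero glaw_variance) auto

lemma lam_f_square: "(lam_f r \<eta>)\<^sup>2 / (2 * r) = lam\<^sup>2 / (2 * (1 + r))"
  using r v01 by (simp add: lam_f_eq power_mult_distrib v_w_eq)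

text \<open>Below \<open>lam_f\<close> the atom \<open>0\<close> is good enough: the mismatch costs \<open>\<theta>\<^sup>2 / (2 r)\<close>, and
  \<open>lam_f\<close> is the value for which this equals the target \<open>lam\<^sup>2 / (2 (1 + r))\<close>.\<close>

lemma risk1_small:
  assumes "\<bar>\<theta>\<bar> \<le> lam_f r \<eta>"
  shows "risk1_le r (threshold1 r \<eta>) \<theta> risk_bound"
proof (rule risk1_atom_zero)
  show "has_bochner_integral (glaw \<theta> 1) (\<lambda>x. (\<theta>\<^sup>2 / (2 * r) + ln 4) + (C0 + (x - \<theta>)\<^sup>2 / 2))
      ((\<theta>\<^sup>2 / (2 * r) + ln 4) + (C0 + 1 / 2))"
    by (intro has_bochner_integral_add[OF _ glaw_square_half] glaw_const) auto
  show "0 \<le> \<theta>\<^sup>2 / (2 * r) + ln 4"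
    using r by simp
  have "\<theta>\<^sup>2 \<le> (lam_f r \<eta>)\<^sup>2"
    using power_mono[OF assms, of 2] by simp
  then have "\<theta>\<^sup>2 / (2 * r) \<le> (lam_f r \<eta>)\<^sup>2 / (2 * r)"
    using r by (intro divide_right_mono) auto
  moreover have "0 \<le> v * a * lam" "0 \<le> ln (8 * K_bound)" "0 \<le> (lam / sqrt v + 2) / r"
    using v01 a_nonneg lam2 K_bound_ge r by auto
  ultimately show "(\<theta>\<^sup>2 / (2 * r) + ln 4) + (C0 + 1 / 2) \<le> risk_bound"
    using lam2 a_nonneg by (simp add: risk_bound_eq lam_f_square)
qed simp

text \<open>For a signal far above the threshold the loss below the threshold is huge, but the event has
  exponentially small probability; \<open>a\<close> is chosen to make the product negligible.\<close>

lemma risk1_large: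
  assumes th: "lam + a \<le> \<bar>\<theta>\<bar>"
  shows "risk1_le r (threshold1 r \<eta>) \<theta> risk_bound"
proof -
  define d where "d = \<bar>\<theta>\<bar> - lam"
  define A where "A = \<theta>\<^sup>2 / (2 * r) + ln 4"
  have d: "a \<le> d" "0 \<le> d"
    using th a_nonneg by (simp_all add: d_def)
  have A0: "0 \<le> A"
    using r by (simp add: A_def)
  have s: "sgn \<theta> * \<theta> = lam + d" "(sgn \<theta>)\<^sup>2 = 1"
    using th lam2 a_nonneg by (auto simp: d_def sgn_if abs_if)
  have "has_bochner_integral (glaw \<theta> 1) (\<lambda>x. A * (exp (d * lam) * exp (- d * sgn \<theta> * x)))
      (A * (exp (d * lam) * exp (- d * sgn \<theta> * \<theta> + (- d * sgn \<theta>)\<^sup>2 * 1 / 2)))"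
    by (intro has_bochner_integral_mult_right glaw_exp) auto
  also have "exp (d * lam) * exp (- d * sgn \<theta> * \<theta> + (- d * sgn \<theta>)\<^sup>2 * 1 / 2) = exp (- d\<^sup>2 / 2)"
  proof -
    have "- d * sgn \<theta> * \<theta> = - d * (lam + d)"
      using s by (simp add: mult.assoc)
    moreover have "(- d * sgn \<theta>)\<^sup>2 = d\<^sup>2"
      using s by (simp add: power_mult_distrib)
    ultimately have "d * lam + (- d * sgn \<theta> * \<theta> + (- d * sgn \<theta>)\<^sup>2 * 1 / 2) = - d\<^sup>2 / 2"
      by (simp only:) (simp add: power2_eq_square algebra_simps)
    then show ?thesis
      by (simp only: exp_add[symmetric])
  qed
  finally have int: "has_bochner_integral (glaw \<theta> 1)
      (\<lambda>x. A * (exp (d * lam) * exp (- d * sgn \<theta> * x))) (A * exp (- d\<^sup>2 / 2))" .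
  show ?thesis
  proof (rule risk1_atom_zero)
    show "has_bochner_integral (glaw \<theta> 1)
        (\<lambda>x. A * (exp (d * lam) * exp (- d * sgn \<theta> * x)) + (C0 + (x - \<theta>)\<^sup>2 / 2))
        (A * exp (- d\<^sup>2 / 2) + (C0 + 1 / 2))"
      by (intro has_bochner_integral_add[OF int glaw_square_half])
    show "0 \<le> A * (exp (d * lam) * exp (- d * sgn \<theta> * x))" for x
      using A0 by simp
    show "\<theta>\<^sup>2 / (2 * r) + ln 4 \<le> A * (exp (d * lam) * exp (- d * sgn \<theta> * x))" if "\<bar>x\<bar> \<le> lam" for x
    proof -
      have "sgn \<theta> * x \<le> lam"
        using that by (auto simp: sgn_if abs_if split: if_splits)
      then have "d * (sgn \<theta> * x) \<le> d * lam"
        using d by (intro mult_left_mono) auto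
      then have "1 \<le> exp (d * lam) * exp (- d * sgn \<theta> * x)"
        by (simp add: mult.assoc flip: exp_add)
      then have "A * 1 \<le> A * (exp (d * lam) * exp (- d * sgn \<theta> * x))"
        using A0 by (intro mult_left_mono) auto
      then show ?thesis
        by (simp add: A_def)
    qed
    \<comment> \<open>Split \<open>\<theta>\<^sup>2\<close> into a part of order \<open>lam\<^sup>2\<close>, damped by \<open>exp (- a\<^sup>2 / 2)\<close>, and a part of order
      \<open>d\<^sup>2\<close>, damped by its own Gaussian factor.\<close>
    have e1: "exp (- d\<^sup>2 / 2) \<le> 1 / lam_f r \<eta>"
      unfolding exp_a[symmetric] using d a_nonneg by simp
    have e2: "d\<^sup>2 / 2 * exp (- d\<^sup>2 / 2) \<le> 1"
    proof -
      have "d\<^sup>2 / 2 \<le> exp (d\<^sup>2 / 2)"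
        using exp_ge_add_one_self[of "d\<^sup>2 / 2"] by linarith
      then have "d\<^sup>2 / 2 * exp (- d\<^sup>2 / 2) \<le> exp (d\<^sup>2 / 2) * exp (- d\<^sup>2 / 2)"
        by (intro mult_right_mono) auto
      then show ?thesis
        by (simp flip: exp_add)
    qed
    have "\<theta>\<^sup>2 = (lam + d)\<^sup>2"
      by (simp add: d_def)
    also have "\<dots> \<le> 2 * lam\<^sup>2 + 4 * (d\<^sup>2 / 2)"
      using sum_squares_bound[of lam d] by (simp add: power2_sum)
    finally have "\<theta>\<^sup>2 * exp (- d\<^sup>2 / 2) \<le> (2 * lam\<^sup>2 + 4 * (d\<^sup>2 / 2)) * exp (- d\<^sup>2 / 2)"
      by (intro mult_right_mono) auto
    also have "\<dots> = 2 * lam\<^sup>2 * exp (- d\<^sup>2 / 2) + 4 * (d\<^sup>2 / 2 * exp (- d\<^sup>2 / 2))"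
      by (simp add: algebra_simps)
    also have "\<dots> \<le> 2 * lam\<^sup>2 * (1 / lam_f r \<eta>) + 4 * 1"
      using e1 e2 by (intro add_mono mult_left_mono) auto
    also have "2 * lam\<^sup>2 * (1 / lam_f r \<eta>) = 2 * (lam / sqrt v)"
      using lam2 by (simp add: lam_f_eq power2_eq_square)
    finally have "\<theta>\<^sup>2 * exp (- d\<^sup>2 / 2) / (2 * r) \<le> (2 * (lam / sqrt v) + 4 * 1) / (2 * r)"
      using r by (intro divide_right_mono) auto
    also have "\<dots> = (lam / sqrt v + 2) / r"
      using r by (simp add: field_simps)
    finally have main: "\<theta>\<^sup>2 / (2 * r) * exp (- d\<^sup>2 / 2) \<le> (lam / sqrt v + 2) / r"
      by simp
    have "ln 4 * exp (- d\<^sup>2 / 2) \<le> ln (4::real) * 1"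
      by (intro mult_left_mono) auto
    then have "A * exp (- d\<^sup>2 / 2) \<le> (lam / sqrt v + 2) / r + ln 4"
      using main unfolding A_def distrib_right by linarith
    moreover have "0 \<le> v * a * lam" "0 \<le> ln (8 * K_bound)" "0 \<le> lam\<^sup>2 / (2 * (1 + r))"
      using v01 a_nonneg lam2 K_bound_ge r by auto
    ultimately show "A * exp (- d\<^sup>2 / 2) + (C0 + 1 / 2) \<le> risk_bound"
      using lam2 a_nonneg by (simp add: risk_bound_eq)
  qed
qed

text \<open>Where the ratio \<open>1 + 2 r\<close> of consecutive support points comes from: for \<open>0 < \<mu> < x\<close> the
  inequality holds exactly up to \<open>x = (1 + 2 r) \<mu>\<close>.\<close>

lemma cluster_spacing:
  assumes "0 < \<mu>" "\<mu> \<le> x" "x \<le> (1 + 2 * r) * \<mu>"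
  shows "(x - \<mu>)\<^sup>2 / v \<le> x\<^sup>2 - \<mu>\<^sup>2"
proof -
  have "x * (1 + r) - \<mu> * (1 + r) \<le> r * (x + \<mu>)"
    using assms(3) by (simp add: algebra_simps)
  then have "(x - \<mu>) * ((x - \<mu>) * (1 + r)) \<le> (x - \<mu>) * (r * (x + \<mu>))"
    using assms by (intro mult_left_mono) (auto simp: algebra_simps)
  then have "(x - \<mu>)\<^sup>2 * (1 + r) \<le> (x\<^sup>2 - \<mu>\<^sup>2) * r"
    by (simp add: power2_eq_square algebra_simps)
  then show ?thesis
    using r by (simp add: v_w_eq pos_divide_le_eq)
qed

text \<open>With the largest support point \<open>m \<le> \<bar>\<theta>\<bar>\<close> as the atom, the mean loss below the threshold is
  \<open>lam\<^sup>2 / 2 + (\<bar>\<theta>\<bar> - m)\<^sup>2 / (2 v) - \<theta>\<^sup>2 / 2\<close> up to a constant, hence at most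
  \<open>(lam\<^sup>2 - m\<^sup>2) / 2\<close> by the spacing. As \<open>m\<close> is at least \<open>nu\<close>, which is nearly \<open>lam_f\<close>, this is
  \<open>(lam\<^sup>2 - lam_f\<^sup>2) / 2 = lam\<^sup>2 / (2 (1 + r))\<close> to first order. The fluctuation of \<open>x\<close> around \<open>\<theta>\<close>
  enters linearly with factor at most \<open>lam + a\<close>, so the restriction to \<open>\<bar>x\<bar> \<le> lam\<close>
  costs only \<open>O (lam)\<close>.\<close>

lemma risk1_medium:
  assumes th: "lam_f r \<eta> \<le> \<bar>\<theta>\<bar>" "\<bar>\<theta>\<bar> \<le> lam + a"
  shows "risk1_le r (threshold1 r \<eta>) \<theta> risk_bound"
proof -
  obtain k where k: "1 \<le> k" "k \<le> K" "support_pt r \<eta> k \<le> \<bar>\<theta>\<bar>" "\<bar>\<theta>\<bar> \<le> (1 + 2 * r) * support_pt r \<eta> k"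
    using exists_support_pt[OF order_trans[OF nu_le th(1)] th(2)] by blast
  define m where "m = support_pt r \<eta> k"
  define \<mu> where "\<mu> = sgn \<theta> * m"
  define q where "q = \<eta> / (2 * real K)"
  define A where "A = lam\<^sup>2 / (2 * (1 + r)) + v * a * lam + ln (8 * K_bound)"
  have th0: "\<theta> \<noteq> 0"
    using th lam_f1 by auto
  have m: "nu r \<eta> \<le> m" "0 < m" "m \<le> \<bar>\<theta>\<bar>" "\<bar>\<theta>\<bar> \<le> (1 + 2 * r) * m"
    using k support_pt_ge support_pt_pos by (simp_all add: m_def)
  have q: "0 < q" "q \<le> pmf P \<mu>"
    using \<eta> num_pts_props(1) pmf_support_pt[OF k(1,2), of "sgn \<theta>"] th0
    by (simp_all add: q_def \<mu>_def m_def abs_sgn_eq)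
  have A0: "0 \<le> A"
    using v01 a_nonneg lam2 K_bound_ge r by (auto simp: A_def intro!: add_nonneg_nonneg)
  have diff: "(\<theta> - \<mu>)\<^sup>2 = (\<bar>\<theta>\<bar> - m)\<^sup>2"
  proof -
    have "\<theta> = sgn \<theta> * \<bar>\<theta>\<bar>"
      by (simp add: sgn_mult_abs)
    then have "\<theta> - \<mu> = sgn \<theta> * (\<bar>\<theta>\<bar> - m)"
      by (metis \<mu>_def right_diff_distrib)
    then show ?thesis
      using th0 by (simp add: power_mult_distrib sgn_if)
  qed
  have ln_q: "ln (2 / q) \<le> lam\<^sup>2 / 2 + ln (8 * K_bound)"
  proof -
    have inv: "1 / \<eta> \<le> 2 * ((1 - \<eta>) / \<eta>)"
      using \<eta> by (simp add: field_simps)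
    have "2 / q = 4 * real K * (1 / \<eta>)"
      by (simp add: q_def)
    also have "\<dots> \<le> 4 * K_bound * (2 * ((1 - \<eta>) / \<eta>))"
      using \<eta> num_pts_props(4) K_bound_ge inv by (intro mult_mono) auto
    also have "\<dots> = 8 * K_bound * ((1 - \<eta>) / \<eta>)"
      by simp
    finally have "ln (2 / q) \<le> ln (8 * K_bound * ((1 - \<eta>) / \<eta>))"
      using q by (intro ln_mono) auto
    also have "\<dots> = ln (8 * K_bound) + ln ((1 - \<eta>) / \<eta>)"
      using K_bound_ge odds_pos by (intro ln_mult_pos) auto
    finally show ?thesis
      by (simp add: lam_square)
  qed
  have expo: "(\<theta> - \<mu>)\<^sup>2 / (2 * r) + ln (2 / q) + \<mu>\<^sup>2 / 2 - \<mu> * x \<le> A - \<mu> * (x - \<theta>)" for x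
  proof -
    have "(\<theta> - \<mu>)\<^sup>2 / (2 * r) + (\<theta> - \<mu>)\<^sup>2 / 2 = (\<theta> - \<mu>)\<^sup>2 / v / 2"
      using r by (simp add: v_w_eq field_simps)
    also have "\<dots> \<le> (\<theta>\<^sup>2 - m\<^sup>2) / 2"
      using cluster_spacing[OF m(2-4)] unfolding diff by simp
    also have "\<dots> \<le> (\<theta>\<^sup>2 - (nu r \<eta>)\<^sup>2) / 2"
      using m(1) nu_pos by (simp add: power_mono)
    also have "\<dots> \<le> (\<theta>\<^sup>2 - (lam_f r \<eta>)\<^sup>2) / 2 + v * a * lam"
      using nu_square_ge by argo
    finally have "(\<theta> - \<mu>)\<^sup>2 / (2 * r) + (\<theta> - \<mu>)\<^sup>2 / 2 \<le> (\<theta>\<^sup>2 - (lam_f r \<eta>)\<^sup>2) / 2 + v * a * lam" .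
    moreover have "(\<theta> - \<mu>)\<^sup>2 / 2 = \<theta>\<^sup>2 / 2 - \<mu> * \<theta> + \<mu>\<^sup>2 / 2"
      by (simp add: power2_eq_square field_simps)
    moreover have "lam\<^sup>2 / 2 - (lam_f r \<eta>)\<^sup>2 / 2 = lam\<^sup>2 / (2 * (1 + r))"
      using r v01 by (simp add: lam_f_eq power_mult_distrib v_w_eq field_simps)
    ultimately show ?thesis
      using ln_q by (simp add: A_def diff_divide_distrib right_diff_distrib)
  qed
  define B where "B = (\<lambda>x. (A + \<bar>\<mu>\<bar> * ((1 + (x - \<theta>)\<^sup>2) / 2)) + (C0 + (x - \<theta>)\<^sup>2 / 2))"
  show ?thesis
  proof (rule risk1_threshold[OF finite_P r q])
    have lin: "- \<mu> * z \<le> \<bar>\<mu>\<bar> * ((1 + z\<^sup>2) / 2)" for z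
    proof -
      have "\<bar>z\<bar> \<le> (1 + z\<^sup>2) / 2"
        using sum_squares_bound[of 1 "\<bar>z\<bar>"] by simp
      then have "\<bar>\<mu>\<bar> * \<bar>z\<bar> \<le> \<bar>\<mu>\<bar> * ((1 + z\<^sup>2) / 2)"
        by (intro mult_left_mono) auto
      moreover have "- \<mu> * z \<le> \<bar>\<mu>\<bar> * \<bar>z\<bar>"
        by (simp flip: abs_mult)
      ultimately show ?thesis
        by linarith
    qed
    show "(\<theta> - \<mu>)\<^sup>2 / (2 * r) + ln (marginal P x / (q * gauss1 \<mu> 1 x)) \<le> B x" if "\<bar>x\<bar> \<le> lam" for x
    proof -
      have "0 \<le> C0 + (x - \<theta>)\<^sup>2 / 2"
        using C0_nonneg by simp
      then show ?thesis
        using ln_marginal_ratio_le[OF that q(1), of \<mu>] expo[of x] lin[of "x - \<theta>"]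
        unfolding B_def by simp
    qed
    show "ln ((1 + r) / r) / 2 + (x - \<theta>)\<^sup>2 / 2 \<le> B x" for x
    proof -
      have "0 \<le> \<bar>\<mu>\<bar> * ((1 + (x - \<theta>)\<^sup>2) / 2)"
        by simp
      then show ?thesis
        using A0 unfolding B_def uniform_loss_def by linarith
    qed
    show "has_bochner_integral (glaw \<theta> 1) B ((A + \<bar>\<mu>\<bar> * ((1 + 1) / 2)) + (C0 + 1 / 2))"
      unfolding B_def
      by (intro has_bochner_integral_add[OF _ glaw_square_half] has_bochner_integral_add glaw_const
          has_bochner_integral_mult_right has_bochner_integral_divide_zero glaw_variance) auto
    have "\<bar>\<mu>\<bar> \<le> lam + a"
      using m th by (simp add: \<mu>_def abs_mult abs_sgn_eq)
    moreover have "0 \<le> (lam / sqrt v + 2) / r"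
      using r lam2 v01 by simp
    moreover have "0 \<le> ln (4::real)" "\<bar>\<mu>\<bar> * ((1 + 1) / 2) = \<bar>\<mu>\<bar>"
      by simp_all
    ultimately show "(A + \<bar>\<mu>\<bar> * ((1 + 1) / 2)) + (C0 + 1 / 2) \<le> risk_bound"
      unfolding risk_bound_eq A_def by linarith
  qed
qed

lemma risk1_all: "risk1_le r (threshold1 r \<eta>) \<theta> risk_bound"
  using risk1_small risk1_medium risk1_large by (meson linear)

text \<open>The \<open>n - s\<close> or more zero coordinates contribute only \<open>O (s lam)\<close> in total.\<close>

lemma sup_risk_le:
  assumes n: "1 \<le> n" and eta: "\<eta> = real s / real n"
  shows "(SUP \<theta>\<in>sparse_vecs n s. risk n r \<theta> (threshold_est n r \<eta>))
    \<le> ereal (real s * (2 * (1 + (C0 + 1) * lam) + risk_bound))"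
proof (rule SUP_least)
  fix \<theta> assume th: "\<theta> \<in> sparse_vecs n s"
  define U where "U = (1 + (C0 + 1) * lam) * (\<eta> / (1 - \<eta>))"
  let ?S = "{i \<in> {..<n}. \<theta> i \<noteq> 0}"
  have c0: "0 \<le> 1 + (C0 + 1) * lam"
    using C0_nonneg lam2 by simp
  have U0: "0 \<le> U"
    using c0 \<eta> by (simp add: U_def)
  have "risk1_le r (threshold1 r \<eta>) (\<theta> i) (if \<theta> i = 0 then U else risk_bound)" for i
    using risk1_zero risk1_all by (simp add: U_def)
  then have "risk n r \<theta> (threshold_est n r \<eta>) \<le> ereal (\<Sum>i<n. if \<theta> i = 0 then U else risk_bound)"
    unfolding threshold_est_def [abs_def]
    by (intro risk_product_le r threshold1_pos finite_P)
  also have "(\<Sum>i<n. if \<theta> i = 0 then U else risk_bound)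
      \<le> (\<Sum>i<n. U + (if i \<in> ?S then risk_bound else 0))"
    using U0 by (intro sum_mono) auto
  also have "\<dots> = real n * U + real (card ?S) * risk_bound"
    by (simp add: sum.distrib flip: sum.inter_filter)
  also have "\<dots> \<le> real n * ((1 + (C0 + 1) * lam) * (2 * \<eta>)) + real s * risk_bound"
  proof (intro add_mono mult_left_mono mult_right_mono)
    have "\<eta> / (1 - \<eta>) \<le> \<eta> / (1 / 2)"
      using \<eta> by (intro divide_left_mono) auto
    then show "U \<le> (1 + (C0 + 1) * lam) * (2 * \<eta>)"
      unfolding U_def using c0 by (intro mult_left_mono) auto
    show "real (card ?S) \<le> real s"
      using th by (simp add: sparse_vecs_def)
    have "0 \<le> v * a * lam" "0 \<le> ln (8 * K_bound)" "0 \<le> lam\<^sup>2 / (2 * (1 + r))"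
      "0 \<le> (lam / sqrt v + 2) / r"
      using v01 a_nonneg lam2 K_bound_ge r by auto
    then show "0 \<le> risk_bound"
      using C0_nonneg lam2 a_nonneg by (simp add: risk_bound_eq)
  qed simp
  also have "\<dots> = real s * (2 * (1 + (C0 + 1) * lam) + risk_bound)"
    using n by (simp add: eta algebra_simps)
  finally show "risk n r \<theta> (threshold_est n r \<eta>)
      \<le> ereal (real s * (2 * (1 + (C0 + 1) * lam) + risk_bound))"
    by simp
qed

lemma minimax_le_sup_risk:
  "minimax_risk n r (sparse_vecs n s)
    \<le> (SUP \<theta>\<in>sparse_vecs n s. risk n r \<theta> (threshold_est n r \<eta>))"
  unfolding minimax_risk_def
  by (rule INF_lower) (simp add: predictive_density_threshold finite_P r)

lemma minimax_ge_lower: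
  assumes n: "1 \<le> n" and eta: "\<eta> = real s / real n"
  shows "ereal (real s * lower_rate r lam) \<le> minimax_risk n r (sparse_vecs n s)"
proof -
  define m where "m = n div s"
  define d where "d = sqrt lam"
  define t where "t = sqrt v * (lam + d)"
  define \<mu> where "\<mu> = sqrt v * (lam + 2 * d)"
  have s: "0 < s"
    using \<eta>(1) n by (cases s) (simp_all add: eta)
  have inv: "1 / \<eta> = real n / real s"
    by (simp add: eta)
  have odds: "(1 - \<eta>) / \<eta> = real n / real s - 1"
    using \<eta>(1) inv by (simp add: diff_divide_distrib)
  have m_le: "real m \<le> real n / real s"
    by (simp add: m_def of_nat_div_le_of_nat)
  have m_ge: "real n / real s - 1 \<le> real m"
  proof -
    have "n = s * m + n mod s" "n mod s < s"
      using s by (simp_all add: m_def)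
    then have "n \<le> s * (m + 1)"
      by simp
    then have "real n \<le> real s * (real m + 1)"
      by (metis of_nat_1 of_nat_add of_nat_le_iff of_nat_mult)
    then show ?thesis
      using s by (simp add: pos_divide_le_eq mult.commute diff_le_eq)
  qed
  have "1 \<le> real n / real s - 1"
    unfolding odds[symmetric] using \<eta> by simp
  then have m0: "0 < m"
    using m_ge by linarith
  have d: "0 \<le> d" "d\<^sup>2 = lam"
    using lam2 by (simp_all add: d_def)
  have mt: "0 \<le> t" "t \<le> \<mu>"
    using v01 lam2 d by (auto simp: t_def \<mu>_def intro!: mult_left_mono)
  have "ereal (real s * (lam\<^sup>2 / 2 * (1 - exp (- (\<mu> - t)\<^sup>2 / (2 * v)) - real m * exp (- t\<^sup>2 / (2 * v)))
      - ln 2 - \<mu>\<^sup>2 / 2)) \<le> minimax_risk n r (sparse_vecs n s)"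
  proof (rule minimax_risk_ge[OF r m0 _ _ _ mt])
    show "s * m \<le> n"
      by (simp add: m_def)
    show "exp (lam\<^sup>2 / 2) \<le> real m"
      using m_ge by (simp add: exp_lam odds)
  qed simp
  moreover have "lower_rate r lam
      \<le> lam\<^sup>2 / 2 * (1 - exp (- (\<mu> - t)\<^sup>2 / (2 * v)) - real m * exp (- t\<^sup>2 / (2 * v))) - ln 2 - \<mu>\<^sup>2 / 2"
  proof -
    have "\<mu> - t = sqrt v * d"
      by (simp add: \<mu>_def t_def algebra_simps)
    then have "(\<mu> - t)\<^sup>2 = v * lam"
      using v01 d by (simp add: power_mult_distrib)
    then have e1: "- (\<mu> - t)\<^sup>2 / (2 * v) = - lam / 2"
      using v01 by simp
    have e2: "- t\<^sup>2 / (2 * v) = - (lam + d)\<^sup>2 / 2"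
      using v01 by (simp add: t_def power_mult_distrib)
    have e3: "\<mu>\<^sup>2 / 2 = v * (lam + 2 * d)\<^sup>2 / 2"
      using v01 by (simp add: \<mu>_def power_mult_distrib)
    have "1 / \<eta> \<le> 2 * ((1 - \<eta>) / \<eta>)"
      using \<eta> by (simp add: field_simps)
    then have "real m \<le> 2 * exp (lam\<^sup>2 / 2)"
      using m_le inv by (simp add: exp_lam)
    then have "real m * exp (- (lam + d)\<^sup>2 / 2) \<le> 2 * exp (lam\<^sup>2 / 2) * exp (- (lam + d)\<^sup>2 / 2)"
      by (intro mult_right_mono) auto
    also have "\<dots> = 2 * exp (lam\<^sup>2 / 2 - (lam + d)\<^sup>2 / 2)"
      by (simp only: mult.assoc exp_add[symmetric]) simp
    finally have "lam\<^sup>2 / 2 * (1 - exp (- lam / 2) - 2 * exp (lam\<^sup>2 / 2 - (lam + d)\<^sup>2 / 2))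
        \<le> lam\<^sup>2 / 2 * (1 - exp (- lam / 2) - real m * exp (- (lam + d)\<^sup>2 / 2))"
      by (intro mult_left_mono) auto
    then show ?thesis
      unfolding e1 e2 e3 lower_rate_def d_def[symmetric] by linarith
  qed
  ultimately show ?thesis
    by (meson ereal_less_eq(3) mult_left_mono of_nat_0_le_iff order_trans)
qed

end

section \<open>Asymptotic minimaxity\<close>

text \<open>The two bounds have the same leading term: \<open>(1 - v) / 2 = 1 / (2 (1 + r))\<close>.\<close>

lemma signal_risk_bound_limit:
  assumes r: "0 < r"
  shows "((\<lambda>l. (2 * (1 + (uniform_loss r + 1) * l) + signal_risk_bound r l) / l\<^sup>2)
    \<longlongrightarrow> 1 / (2 * (1 + r))) at_top"
proof -
  define w where "w = sqrt (v_w r)"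
  define c where "c = uniform_loss r"
  define f where "f = (\<lambda>l. sqrt (2 * ln (w * l)))"
  have w: "0 < w"
    using v_w_pos[OF r] by (simp add: w_def)
  define k where "k = 2 + ln (8 * cluster_size_bound r) + c + 1 / 2 + ln 4 + 2 / r"
  have f1: "((\<lambda>l. f l / l) \<longlongrightarrow> 0) at_top"
    unfolding f_def using w by real_asymp
  have f2: "((\<lambda>l. f l / l\<^sup>2) \<longlongrightarrow> 0) at_top"
    unfolding f_def using w by real_asymp
  have i1: "((\<lambda>l::real. 1 / l) \<longlongrightarrow> 0) at_top" and i2: "((\<lambda>l::real. 1 / l\<^sup>2) \<longlongrightarrow> 0) at_top"
    by real_asymp+
  have "((\<lambda>l. 1 / (2 * (1 + r)) + v_w r * (f l / l) + (2 * (c + 1) + 1 + 1 / (w * r)) * (1 / l)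
      + f l / l\<^sup>2 + k * (1 / l\<^sup>2))
      \<longlongrightarrow> 1 / (2 * (1 + r)) + v_w r * 0 + (2 * (c + 1) + 1 + 1 / (w * r)) * 0 + 0 + k * 0) at_top"
    by (intro tendsto_intros f1 f2 i1 i2)
  moreover have "\<forall>\<^sub>F l in at_top. (2 * (1 + (c + 1) * l) + signal_risk_bound r l) / l\<^sup>2
      = 1 / (2 * (1 + r)) + v_w r * (f l / l) + (2 * (c + 1) + 1 + 1 / (w * r)) * (1 / l)
      + f l / l\<^sup>2 + k * (1 / l\<^sup>2)"
    using eventually_gt_at_top[of 0]
  proof eventually_elim
    case (elim l)
    have "2 * (1 + (c + 1) * l) + signal_risk_bound r l
        = l\<^sup>2 * (1 / (2 * (1 + r))) + l * (v_w r * f l) + l * (2 * (c + 1) + 1 + 1 / (w * r)) + f l + k"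
      by (simp add: signal_risk_bound_def f_def w_def c_def k_def add_divide_distrib algebra_simps)
    then show ?case
      using elim by (simp add: add_divide_distrib power2_eq_square)
  qed
  ultimately show ?thesis
    unfolding c_def by (simp add: tendsto_cong)
qed

lemma lower_rate_limit:
  assumes r: "0 < r"
  shows "((\<lambda>l. lower_rate r l / l\<^sup>2) \<longlongrightarrow> 1 / (2 * (1 + r))) at_top"
proof -
  have 1: "((\<lambda>l::real. (1 - exp (- l / 2) - 2 * exp (l\<^sup>2 / 2 - (l + sqrt l)\<^sup>2 / 2)) / 2) \<longlongrightarrow> 1 / 2) at_top"
    by real_asymp
  have 2: "((\<lambda>l::real. ln 2 / l\<^sup>2) \<longlongrightarrow> 0) at_top"
    by real_asymp
  have 3: "((\<lambda>l::real. (l + 2 * sqrt l)\<^sup>2 / 2 / l\<^sup>2) \<longlongrightarrow> 1 / 2) at_top"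
    by real_asymp
  have "((\<lambda>l. (1 - exp (- l / 2) - 2 * exp (l\<^sup>2 / 2 - (l + sqrt l)\<^sup>2 / 2)) / 2 - ln 2 / l\<^sup>2
      - v_w r * ((l + 2 * sqrt l)\<^sup>2 / 2 / l\<^sup>2)) \<longlongrightarrow> 1 / 2 - 0 - v_w r * (1 / 2)) at_top"
    by (intro tendsto_intros 1 2 3)
  moreover have "1 / 2 - 0 - v_w r * (1 / 2) = 1 / (2 * (1 + r))"
    using r by (simp add: v_w_eq field_simps)
  moreover have "\<forall>\<^sub>F l in at_top. lower_rate r l / l\<^sup>2
      = (1 - exp (- l / 2) - 2 * exp (l\<^sup>2 / 2 - (l + sqrt l)\<^sup>2 / 2)) / 2 - ln 2 / l\<^sup>2
      - v_w r * ((l + 2 * sqrt l)\<^sup>2 / 2 / l\<^sup>2)"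
    using eventually_gt_at_top[of 0]
    by eventually_elim (simp add: lower_rate_def diff_divide_distrib)
  ultimately show ?thesis
    by (simp add: tendsto_cong)
qed

theorem mainTheorem3:
  fixes r :: real and s :: "nat \<Rightarrow> nat"
  assumes "0 < r"
    and "\<And>n. 1 \<le> n \<Longrightarrow> 1 \<le> s n \<and> s n \<le> n"
    and "(\<lambda>n. real (s n) / real n) \<longlonglongrightarrow> 0"
  shows "\<exists>\<epsilon> :: nat \<Rightarrow> real. \<epsilon> \<longlonglongrightarrow> 0 \<and>
    (\<forall>\<^sub>F n in sequentially.
       (SUP \<theta> \<in> sparse_vecs n (s n). risk n r \<theta> (threshold_est n r (real (s n) / real n))) =
       minimax_risk n r (sparse_vecs n (s n)) * ereal (1 + \<epsilon> n))"
proof -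
  note r = assms(1)
  define \<eta> where "\<eta> = (\<lambda>n. real (s n) / real n)"
  define l where "l = (\<lambda>n. lam_e (\<eta> n))"
  define up where "up = (\<lambda>x. 2 * (1 + (uniform_loss r + 1) * x) + signal_risk_bound r x)"
  define S where "S = (\<lambda>n. SUP \<theta> \<in> sparse_vecs n (s n). risk n r \<theta> (threshold_est n r (\<eta> n)))"
  define R where "R = (\<lambda>n. minimax_risk n r (sparse_vecs n (s n)))"
  define \<epsilon> where "\<epsilon> = (\<lambda>n. real_of_ereal (S n) / real_of_ereal (R n) - 1)"
  have \<eta>_pos: "\<forall>\<^sub>F n in sequentially. 0 < \<eta> n"
    using eventually_ge_at_top[of 1] by eventually_elim (use assms(2) in \<open>force simp: \<eta>_def\<close>)
  then have "\<forall>\<^sub>F n in sequentially. \<eta> n \<in> {0<..} \<and> \<eta> n \<noteq> 0"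
    by eventually_elim simp
  then have \<eta>_lim: "filterlim \<eta> (at_right 0) sequentially"
    using assms(3) unfolding filterlim_at \<eta>_def by blast
  have "filterlim lam_e at_top (at_right 0)"
    unfolding lam_e_def [abs_def] by real_asymp
  then have l_lim: "filterlim l at_top sequentially"
    unfolding l_def using \<eta>_lim by (rule filterlim_compose)
  have "((\<lambda>x. (up x / x\<^sup>2) / (lower_rate r x / x\<^sup>2)) \<longlongrightarrow> (1 / (2 * (1 + r))) / (1 / (2 * (1 + r)))) at_top"
    unfolding up_def using r
    by (intro tendsto_divide signal_risk_bound_limit lower_rate_limit) auto
  then have "((\<lambda>x. (up x / x\<^sup>2) / (lower_rate r x / x\<^sup>2)) \<longlongrightarrow> 1) at_top"
    using r by simp
  moreover have "\<forall>\<^sub>F x in at_top. (up x / x\<^sup>2) / (lower_rate r x / x\<^sup>2) = up x / lower_rate r x"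
    using eventually_gt_at_top[of 0] by eventually_elim simp
  ultimately have "((\<lambda>x. up x / lower_rate r x) \<longlongrightarrow> 1) at_top"
    by (rule Lim_transform_eventually)
  then have "(\<lambda>n. up (l n) / lower_rate r (l n)) \<longlonglongrightarrow> 1"
    using l_lim by (rule filterlim_compose)
  then have ratio: "(\<lambda>n. up (l n) / lower_rate r (l n) - 1) \<longlonglongrightarrow> 1 - 1"
    by (intro tendsto_diff tendsto_const)
  have "\<forall>\<^sub>F x in at_top. 0 < lower_rate r x / x\<^sup>2"
    using lower_rate_limit[OF r] r by (intro order_tendstoD(1)[of _ "1 / (2 * (1 + r))"]) auto
  then have "\<forall>\<^sub>F n in sequentially. 0 < lower_rate r (l n) / (l n)\<^sup>2"
    using l_lim by (rule eventually_compose_filterlim)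
  then have lower_pos: "\<forall>\<^sub>F n in sequentially. 0 < lower_rate r (l n)"
    by eventually_elim (simp add: zero_less_divide_iff)
  have large: "\<forall>\<^sub>F n in sequentially. c \<le> l n" for c
    using l_lim by (simp add: filterlim_at_top)
  have small: "\<forall>\<^sub>F n in sequentially. \<eta> n \<le> 1 / 2"
    using order_tendstoD(2)[OF assms(3), of "1 / 2"] by (auto simp: \<eta>_def elim: eventually_mono)
  have bounds: "\<forall>\<^sub>F n in sequentially. 0 \<le> \<epsilon> n \<and> \<epsilon> n \<le> up (l n) / lower_rate r (l n) - 1
      \<and> S n = R n * ereal (1 + \<epsilon> n)"
    using \<eta>_pos small lower_pos large[of 2] large[of "1 / sqrt (v_w r)"] eventually_ge_at_top[of 1]
  proof eventually_elim
    case (elim n)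
    have "1 \<le> lam_f r (\<eta> n)"
      using elim(5) v_w_pos[OF r] by (simp add: lam_f_def l_def field_simps)
    then interpret small_sparsity r "\<eta> n"
      using elim r by unfold_locales (auto simp: l_def)
    have n: "1 \<le> n" and eta: "\<eta> n = real (s n) / real n"
      using elim by (simp_all add: \<eta>_def)
    have s: "0 < real (s n)"
      using assms(2)[OF n] by simp
    have SU: "S n \<le> ereal (real (s n) * up (l n))"
      using sup_risk_le[OF n eta] by (simp add: S_def up_def l_def)
    have RS: "R n \<le> S n"
      using minimax_le_sup_risk by (simp add: R_def S_def)
    have LR: "ereal (real (s n) * lower_rate r (l n)) \<le> R n"
      using minimax_ge_lower[OF n eta] by (simp add: R_def l_def)
    obtain \<rho> where \<rho>: "R n = ereal \<rho>"
      using LR RS SU by (cases "R n") auto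
    obtain \<sigma> where \<sigma>: "S n = ereal \<sigma>"
      using SU RS \<rho> by (cases "S n") auto
    have le: "real (s n) * lower_rate r (l n) \<le> \<rho>" "\<rho> \<le> \<sigma>" "\<sigma> \<le> real (s n) * up (l n)"
      using LR RS SU by (simp_all add: \<rho> \<sigma>)
    have pos: "0 < real (s n) * lower_rate r (l n)"
      using s elim(3) by simp
    have "\<sigma> / \<rho> \<le> (real (s n) * up (l n)) / (real (s n) * lower_rate r (l n))"
      using le pos by (intro frac_le) auto
    then have "\<sigma> / \<rho> \<le> up (l n) / lower_rate r (l n)"
      using s by simp
    then show ?case
      using le pos by (simp add: \<epsilon>_def \<rho> \<sigma>)
  qed
  have "\<epsilon> \<longlonglongrightarrow> 0"
  proof (rule tendsto_sandwich)
    show "\<forall>\<^sub>F n in sequentially. 0 \<le> \<epsilon> n"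
      using bounds by (auto elim: eventually_mono)
    show "\<forall>\<^sub>F n in sequentially. \<epsilon> n \<le> up (l n) / lower_rate r (l n) - 1"
      using bounds by (auto elim: eventually_mono)
    show "(\<lambda>n. up (l n) / lower_rate r (l n) - 1) \<longlonglongrightarrow> 0"
      using ratio by simp
  qed simp
  moreover have "\<forall>\<^sub>F n in sequentially. S n = R n * ereal (1 + \<epsilon> n)"
    using bounds by (auto elim: eventually_mono)
  ultimately show ?thesis
    unfolding S_def R_def \<eta>_def by blast
qed

end
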